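(* The composition of the upper incomplete Riemann--Liouville fractional integral with the standard operation of differentiation is given by the following identities: $$\frac{\mathrm{d}}{\mathrm{d}x}\Big({}^{RL}_{0}D_x^{-\mu}\{f(x);y\}\Big)=-\frac{y(1-y)^{\mu-1}}{\Gamma(\mu)}x^{\mu-1}f(xy)+{}^{RL}_{0}D^{1-\mu}_x\{f(x);y\},$$ $${}^{RL}_{0}D_x^{-\mu}\{f'(x);y\}=-\frac{x^{\mu-1}}{\Gamma(\mu)}(1-y)^{\mu-1}f(xy)+{}^{RL}_{0}D^{1-\mu}_x\{f(x);y\},$$ valid for $\mu\in\mathbb{C}$ with $\mathrm{Re}(\mu)>1$ and for $f,x,y$ satisfying the appropriate criteria under which the upper incomplete Riemann--Liouville fractional integrals of $f$ of orders $\mu$ and $\mu-1$ are defined, namely $b>0$, $0<y<1$, $x\in[0,b]$, and $f:[0,b]\to\mathbb{C}$ with $f\in L^1[0,b]$ if $\mathrm{Re}(\mu)>2$ and $f\in L^{\infty}[0,b]$ if $1<\mathrm{Re}(\mu)\leq2$.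
   Context: For $b>0$, $0<y<1$, and $\nu\in\mathbb{C}$ with $\mathrm{Re}(\nu)>0$, the upper incomplete Riemann--Liouville fractional integral of order $\nu$ of a function $h$ is $${}^{RL}_{0}D_x^{-\nu}\{h(x);y\}=\frac{1}{\Gamma(\nu)}\int_{yx}^{x}(x-t)^{\nu-1}h(t)\,\mathrm{d}t,\qquad x\in[0,b],$$ defined for $h\in L^1[0,b]$ when $\mathrm{Re}(\nu)>1$ and for $h\in L^{\infty}[0,b]$ when $0<\mathrm{Re}(\nu)\leq1$. Thus ${}^{RL}_{0}D_x^{1-\mu}\{f(x);y\}$ is the integral of $f$ of order $\mu-1$, and ${}^{RL}_{0}D_x^{-\mu}\{f'(x);y\}$ is the integral of order $\mu$ applied to the derivative $f'$ of $f$.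
   Formalization: The first identity is proved for almost every x in [0,b], and for every x such that f is continuous at xy; in the second, f' is integrable on [xy,x] and is the derivative of f there, everywhere or almost everywhere with f absolutely continuous. *)

theory Defs
  imports "HOL-Analysis.Analysis"
begin

(* The base of the complex power is the real number x - t, which is nonnegative for t in
   {y*x..x}, so powr is the usual principal power; the value 0 powr _ = 0 only enters at the
   single point t = x.  The integral is the Lebesgue integral. *)
definition RL_upper :: "real \<Rightarrow> complex \<Rightarrow> (real \<Rightarrow> complex) \<Rightarrow> real \<Rightarrow> complex" where
  "RL_upper y \<nu> h x =
     1 / Gamma \<nu> *
       set_lebesgue_integral lebesgue {y * x..x} (\<lambda>t. of_real (x - t) powr (\<nu> - 1) * h t)"

(* Membership in L^1[a,b] is set_integrable lebesgue {a..b}; this is L^infinity[a,b]. *)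
definition Linf_on :: "real \<Rightarrow> real \<Rightarrow> (real \<Rightarrow> complex) \<Rightarrow> bool" where
  "Linf_on a b h \<longleftrightarrow>
     set_borel_measurable lebesgue {a..b} h \<and>
     (\<exists>C. AE t\<in>{a..b} in lebesgue. norm (h t) \<le> C)"

(* Absolute continuity in the epsilon-delta sense.  A division is a finite set of nonempty
   closed intervals {u..v} with disjoint interiors, for which u = Inf K and v = Sup K. *)
definition abs_continuous_on :: "real \<Rightarrow> real \<Rightarrow> (real \<Rightarrow> complex) \<Rightarrow> bool" where
  "abs_continuous_on a b f \<longleftrightarrow>
     (\<forall>\<epsilon>>0. \<exists>\<delta>>0. \<forall>D. D division_of \<Union>D \<and> \<Union>D \<subseteq> {a..b} \<and> (\<Sum>K\<in>D. Sup K - Inf K) < \<delta> \<longrightarrow>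
        (\<Sum>K\<in>D. norm (f (Sup K) - f (Inf K))) < \<epsilon>)"

(* "f' is the derivative of f on [a,b]": either in the classical sense at every point (one-sided
   at the endpoints), or, as is customary for functions given up to null sets, almost everywhere,
   in which case f has to be absolutely continuous (consider the Cantor function). *)
definition derivative_on :: "real \<Rightarrow> real \<Rightarrow> (real \<Rightarrow> complex) \<Rightarrow> (real \<Rightarrow> complex) \<Rightarrow> bool" where
  "derivative_on a b f f' \<longleftrightarrow>
     (\<forall>t\<in>{a..b}. (f has_vector_derivative f' t) (at t within {a..b})) \<or>
     (abs_continuous_on a b f \<and>
       (AE t\<in>{a..b} in lebesgue. (f has_vector_derivative f' t) (at t within {a..b})))"

end

theory Submission
  imports Defs
begin

text \<open>Put \<open>\<nu> = \<mu> - 1\<close>, so that \<open>0 < Re \<nu>\<close>.  Up to the factor \<open>1 / Gamma \<mu>\<close> the integral of order \<open>\<mu>\<close> is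
the integral of \<open>(x - t) powr \<nu> * f t\<close> over \<open>{y * x..x}\<close>, and differentiating the kernel produces the factor
\<open>\<nu>\<close>, which turns \<open>1 / Gamma \<mu>\<close> into \<open>1 / Gamma (\<mu> - 1)\<close>.

For the first identity three effects are separated.  Differentiation under the integral sign
(\<open>kernel_integral_has_vector_derivative\<close>) yields the integral of order \<open>\<mu> - 1\<close>.  For \<open>Re \<nu> \<le> 1\<close> the derivative of the
kernel may be singular, but its difference quotients are dominated by \<open>s powr (Re \<nu> - 1)\<close>, which is integrable and
is multiplied by a bounded \<open>f\<close>; for \<open>Re \<nu> > 1\<close> they are bounded and \<open>f\<close> is only integrable.  The moving upper
limit contributes nothing (\<open>kernel_tail_has_vector_derivative\<close>), as the kernel vanishes there.  The moving lower limit
\<open>y * x\<close> contributes the boundary term (\<open>kernel_moving_limit_has_vector_derivative\<close>) wherever, at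
\<open>y * x\<close>, the indefinite integral of \<open>f\<close> has the derivative \<open>f (y * x)\<close> and that of its norm is differentiable.  That is the case at every point of continuity of \<open>f\<close>,
and almost everywhere by Lebesgue's differentiation theorem (\<open>indefinite_integral_has_vector_derivative_AE\<close>).

The second identity is integration by parts (\<open>kernel_integration_by_parts\<close>); the boundary term at \<open>t = x\<close> vanishes
with the kernel.  For absolutely continuous \<open>f\<close> it rests on the corresponding fundamental theorem of calculus
(\<open>has_integral_derivative_abs_continuous\<close>).\<close>

section \<open>Lebesgue differentiation on the line\<close>

text \<open>Henstock's lemma makes the sum of the deviations over any partial division by sufficiently short
intervals as small as desired.  At every point of the exceptional set arbitrarily short such intervals
have a deviation larger than \<open>e\<close> times their length, so Vitali's covering theorem extracts a disjoint
family of them that covers the set up to a null set; its total length is therefore as small as desired.\<close>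
lemma negligible_indefinite_integral_deviation:
  fixes f :: "real \<Rightarrow> 'a::euclidean_space"
  assumes f: "f integrable_on {a..b}" and "0 < e"
  shows "negligible {x. \<forall>d>0. \<exists>u v. u < v \<and> x \<in> {u..v} \<and> {u..v} \<subseteq> {a..b} \<and> {u..v} \<subseteq> ball x d \<and>
            e * (v - u) < norm ((v - u) *\<^sub>R f x - integral {u..v} f)}" (is "negligible ?E")
  unfolding negligible_outer_le
proof (intro allI impI)
  fix \<eta> :: real assume "0 < \<eta>"
  then have "0 < e * \<eta>" using \<open>0 < e\<close> by simp
  obtain \<gamma> where "gauge \<gamma>" and \<gamma>:
    "\<And>p. \<lbrakk>p tagged_partial_division_of cbox a b; \<gamma> fine p\<rbrakk> \<Longrightarrow>
        (\<Sum>(x,K)\<in>p. norm (measure lborel K *\<^sub>R f x - integral K f)) < e * \<eta>"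
    using Henstock_lemma[of f a b "e * \<eta>"] f \<open>0 < e * \<eta>\<close> unfolding box_real by blast
  \<comment> \<open>The candidate intervals: short with respect to the gauge at \<open>x\<close>, and with a large deviation.  As closed balls they
    are centred at their midpoints; the tag \<open>x\<close> may be any of their points.\<close>
  define Q where "Q = {(x,u,v). u < v \<and> x \<in> {u..v} \<and> {u..v} \<subseteq> {a..b} \<and> {u..v} \<subseteq> \<gamma> x \<and>
     e * (v - u) < norm ((v - u) *\<^sub>R f x - integral {u..v} f)}"
  define mid where "mid = (\<lambda>(x::real,u::real,v::real). (u + v) / 2)"
  define rad where "rad = (\<lambda>(x::real,u::real,v::real). (v - u) / 2)"
  have cball: "cball (mid (x,u,v)) (rad (x,u,v)) = {u..v}" for x u v
    by (simp add: mid_def rad_def cball_eq_atLeastAtMost field_simps)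
  have "\<exists>i. i \<in> Q \<and> x \<in> cball (mid i) (rad i) \<and> rad i < d" if "x \<in> ?E" "0 < d" for x d
  proof -
    have "open (\<gamma> x)" "x \<in> \<gamma> x" using \<open>gauge \<gamma>\<close> by (auto simp: gauge_def)
    then obtain r where "r > 0" "ball x r \<subseteq> \<gamma> x" using openE by blast
    have "0 < min d r" using \<open>0 < d\<close> \<open>0 < r\<close> by simp
    with \<open>x \<in> ?E\<close> obtain u v where uv: "u < v" "x \<in> {u..v}" "{u..v} \<subseteq> {a..b}"
      "{u..v} \<subseteq> ball x (min d r)" "e * (v - u) < norm ((v - u) *\<^sub>R f x - integral {u..v} f)"
      by blast
    have "{u..v} \<subseteq> \<gamma> x" using uv(4) \<open>ball x r \<subseteq> \<gamma> x\<close> by (auto simp: subset_iff)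
    with uv have "(x,u,v) \<in> Q" by (simp add: Q_def)
    moreover have "rad (x,u,v) < d"
    proof -
      have "u \<in> {u..v}" "v \<in> {u..v}" using \<open>u < v\<close> by auto
      then have "u \<in> ball x (min d r)" "v \<in> ball x (min d r)" using uv(4) by blast+
      then show ?thesis by (auto simp: rad_def dist_real_def)
    qed
    ultimately show ?thesis using uv(2) cball by blast
  qed
  note cover = this
  have rad: "0 < rad i" if "i \<in> Q" for i using that by (auto simp: Q_def rad_def)
  obtain C where "countable C" "C \<subseteq> Q"
    and dis: "pairwise (\<lambda>i j. disjnt (cball (mid i) (rad i)) (cball (mid j) (rad j))) C"
    and neg: "negligible (?E - (\<Union>i\<in>C. cball (mid i) (rad i)))"
    by (rule Vitali_covering_theorem_cballs[of Q rad ?E mid, OF rad cover])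
  let ?B = "\<lambda>i. cball (mid i) (rad i)"
  have bound: "measure lebesgue (\<Union>i\<in>I. ?B i) \<le> \<eta>" if "I \<subseteq> C" "finite I" for I
  proof -
    define p where "p = (\<lambda>i. (fst i, ?B i)) ` I"
    \<comment> \<open>Needed to sum over indices instead of tagged intervals: equal balls meet, whereas distinct indices have
      disjoint balls.\<close>
    have inj: "inj_on (\<lambda>i. (fst i, ?B i)) I"
    proof (rule inj_onI)
      fix i j assume ij: "i \<in> I" "j \<in> I" "(fst i, ?B i) = (fst j, ?B j)"
      have "0 < rad i" using ij(1) \<open>I \<subseteq> C\<close> \<open>C \<subseteq> Q\<close> by (intro rad) blast
      then have "mid i \<in> ?B i" by simp
      moreover have "?B i = ?B j" using ij by simp
      ultimately have "\<not> disjnt (?B i) (?B j)" unfolding disjnt_def by blast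
      then show "i = j" using pairwiseD[OF dis, of i j] ij(1,2) \<open>I \<subseteq> C\<close> by blast
    qed
    have p: "p tagged_partial_division_of cbox a b"
      unfolding tagged_partial_division_of_def
    proof (intro conjI allI impI)
      show "finite p" using \<open>finite I\<close> by (simp add: p_def)
      fix x K assume "(x, K) \<in> p"
      then obtain u v where "(x,u,v) \<in> I" "K = {u..v}"
        by (auto simp: p_def cball)
      moreover have "(x,u,v) \<in> Q" using calculation that \<open>C \<subseteq> Q\<close> by blast
      ultimately show "x \<in> K" "K \<subseteq> cbox a b" "\<exists>a b. K = cbox a b"
        unfolding box_real by (auto simp: Q_def)
    next
      fix x1 K1 x2 K2 assume *: "(x1, K1) \<in> p \<and> (x2, K2) \<in> p \<and> (x1, K1) \<noteq> (x2, K2)"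
      then obtain i j where "i \<in> I" "j \<in> I" "K1 = ?B i" "K2 = ?B j" "i \<noteq> j"
        unfolding p_def by blast
      then have "disjnt K1 K2" using dis that by (auto simp: pairwise_def)
      then show "interior K1 \<inter> interior K2 = {}"
        using interior_subset[of K1] interior_subset[of K2] unfolding disjnt_def by blast
    qed
    have "\<gamma> fine p"
    proof (rule fineI)
      fix x K assume "(x, K) \<in> p"
      then obtain u v where "(x,u,v) \<in> I" "K = {u..v}"
        by (auto simp: p_def cball)
      moreover have "(x,u,v) \<in> Q" using calculation that \<open>C \<subseteq> Q\<close> by blast
      ultimately show "K \<subseteq> \<gamma> x" by (simp add: Q_def)
    qed
    have "e * (\<Sum>i\<in>I. measure lebesgue (?B i))
        \<le> (\<Sum>i\<in>I. norm (measure lborel (?B i) *\<^sub>R f (fst i) - integral (?B i) f))"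
      unfolding sum_distrib_left
    proof (rule sum_mono)
      fix i assume "i \<in> I"
      moreover obtain x u v where i: "i = (x,u,v)" by (cases i)
      ultimately have "(x,u,v) \<in> Q" using that \<open>C \<subseteq> Q\<close> by auto
      then show "e * measure lebesgue (?B i) \<le> norm (measure lborel (?B i) *\<^sub>R f (fst i) - integral (?B i) f)"
        unfolding i cball by (auto simp: Q_def)
    qed
    also have "\<dots> = (\<Sum>(x,K)\<in>p. norm (measure lborel K *\<^sub>R f x - integral K f))"
      unfolding p_def by (subst sum.reindex[OF inj]) (simp add: o_def)
    also have "\<dots> < e * \<eta>" by (rule \<gamma>[OF p \<open>\<gamma> fine p\<close>])
    finally have "(\<Sum>i\<in>I. measure lebesgue (?B i)) < \<eta>" using \<open>0 < e\<close> by simp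
    moreover have "measure lebesgue (\<Union>i\<in>I. ?B i) \<le> (\<Sum>i\<in>I. measure lebesgue (?B i))"
      by (rule measure_UNION_le[OF \<open>finite I\<close>]) auto
    ultimately show ?thesis by linarith
  qed
  have U: "(\<Union>i\<in>C. ?B i) \<in> lmeasurable" "measure lebesgue (\<Union>i\<in>C. ?B i) \<le> \<eta>"
    by (rule fmeasurable_UN_bound[OF \<open>countable C\<close> _ bound]
             measure_UN_bound[OF \<open>countable C\<close> _ bound]; simp)+
  let ?T = "(\<Union>i\<in>C. ?B i) \<union> (?E - (\<Union>i\<in>C. ?B i))"
  show "\<exists>T. ?E \<subseteq> T \<and> T \<in> lmeasurable \<and> measure lebesgue T \<le> \<eta>"
  proof (intro exI conjI)
    show "?E \<subseteq> ?T" by blast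
    have null: "?E - (\<Union>i\<in>C. ?B i) \<in> null_sets lebesgue"
      using neg by (simp add: negligible_iff_null_sets)
    then show "?T \<in> lmeasurable"
      using U(1) neg negligible_imp_measurable by (intro fmeasurable.Un) blast+
    show "measure lebesgue ?T \<le> \<eta>"
      using U null by (subst measure_Un_null_set) (auto simp: fmeasurableD)
  qed
qed

text \<open>Lebesgue's differentiation theorem on the line: the points where the indefinite integral fails to
have the right derivative lie in the countable union of the null sets above, one for each deviation
\<open>1 / (n + 1)\<close>.\<close>
theorem indefinite_integral_has_vector_derivative_AE:
  fixes f :: "real \<Rightarrow> 'a::euclidean_space"
  assumes f: "f integrable_on {a..b}"
  shows "negligible {x\<in>{a..b}. \<not> ((\<lambda>u. integral {a..u} f) has_vector_derivative f x) (at x within {a..b})}"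
    (is "negligible ?N")
proof -
  let ?E = "\<lambda>e. {x. \<forall>d>0. \<exists>u v. u < v \<and> x \<in> {u..v} \<and> {u..v} \<subseteq> {a..b} \<and> {u..v} \<subseteq> ball x d \<and>
            e * (v - u) < norm ((v - u) *\<^sub>R f x - integral {u..v} f)}"
  have "?N \<subseteq> (\<Union>n. ?E (inverse (real (Suc n))))"
  proof
    fix x assume "x \<in> ?N"
    then have x: "x \<in> {a..b}" and "\<not> ((\<lambda>u. integral {a..u} f) has_vector_derivative f x) (at x within {a..b})"
      by auto
    then obtain e where "0 < e" and e: "\<And>d. 0 < d \<Longrightarrow> \<exists>z\<in>{a..b}. norm (z - x) < d \<and>
        e * norm (z - x) < norm (integral {a..z} f - integral {a..x} f - (z - x) *\<^sub>R f x)"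
      unfolding has_vector_derivative_def has_derivative_within_alt
      by (auto simp: bounded_linear_scaleR_left not_le)
    obtain n where n: "inverse (real (Suc n)) < e"
      using reals_Archimedean[OF \<open>0 < e\<close>] by blast
    have "x \<in> ?E (inverse (real (Suc n)))"
    proof (intro CollectI allI impI)
      fix d :: real assume "0 < d"
      then obtain z where z: "z \<in> {a..b}" "norm (z - x) < d"
        "e * norm (z - x) < norm (integral {a..z} f - integral {a..x} f - (z - x) *\<^sub>R f x)"
        using e by blast
      \<comment> \<open>The interval between \<open>x\<close> and \<open>z\<close>, which has \<open>x\<close> as an endpoint, witnesses the deviation.\<close>
      define u v where "u = min x z" and "v = max x z"
      have "z \<noteq> x" using z(3) by auto
      have split: "integral {a..q} f - integral {a..p} f = integral {p..q} f"
        if "p \<le> q" "p \<in> {a..b}" "q \<in> {a..b}" for p q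
        using that Henstock_Kurzweil_Integration.integral_combine[of a p q f]
          integrable_on_subinterval[OF f, of a q]
        by (auto simp: algebra_simps)
      have eq: "norm ((v - u) *\<^sub>R f x - integral {u..v} f)
          = norm (integral {a..z} f - integral {a..x} f - (z - x) *\<^sub>R f x)"
      proof (cases "x \<le> z")
        case True
        then show ?thesis
          using x z(1) split[of x z] norm_minus_commute[of "(z - x) *\<^sub>R f x"] by (simp add: u_def v_def)
      next
        case False
        then have "integral {a..z} f - integral {a..x} f = - integral {z..x} f"
          using x z(1) split[of z x] by (simp add: algebra_simps)
        moreover have "(v - u) *\<^sub>R f x - integral {u..v} f = - integral {z..x} f - (z - x) *\<^sub>R f x"
          using False by (simp add: u_def v_def algebra_simps)
        ultimately show ?thesis by simp
      qed
      have "inverse (real (Suc n)) * (v - u) \<le> e * norm (z - x)"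
        using n \<open>0 < e\<close> by (intro mult_mono) (auto simp: u_def v_def)
      with z(3) eq have "inverse (real (Suc n)) * (v - u) < norm ((v - u) *\<^sub>R f x - integral {u..v} f)"
        by linarith
      moreover have "u < v" "x \<in> {u..v}" "{u..v} \<subseteq> {a..b}" "{u..v} \<subseteq> ball x d"
        using \<open>z \<noteq> x\<close> x z(1,2) by (auto simp: u_def v_def dist_real_def)
      ultimately show "\<exists>u v. u < v \<and> x \<in> {u..v} \<and> {u..v} \<subseteq> {a..b} \<and> {u..v} \<subseteq> ball x d \<and>
            inverse (real (Suc n)) * (v - u) < norm ((v - u) *\<^sub>R f x - integral {u..v} f)"
        by blast
    qed
    then show "x \<in> (\<Union>n. ?E (inverse (real (Suc n))))" by blast
  qed
  moreover have "negligible (\<Union>n. ?E (inverse (real (Suc n))))"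
    by (intro negligible_Union_nat negligible_indefinite_integral_deviation[OF f]) simp
  ultimately show ?thesis by (rule negligible_subset[rotated])
qed

lemma AE_lebesgue_iff_negligible: "(AE t in lebesgue. P t) \<longleftrightarrow> negligible {t. \<not> P t}"
  by (simp add: completion.AE_iff_null_sets negligible_iff_null_sets)

section \<open>Absolutely continuous functions\<close>

text \<open>The fundamental theorem of calculus for absolutely continuous functions, read off from the gauge
definition of the integral.  Tags outside the null set contribute a small error because \<open>F\<close> is
differentiable there.  The gauge forces all intervals tagged in the null set into an open set of
measure less than \<open>\<delta>\<close>, and absolute continuity then bounds the total variation of \<open>F\<close> over them.\<close>
theorem has_integral_derivative_abs_continuous:
  fixes F f :: "real \<Rightarrow> complex"
  assumes "a \<le> b" and ac: "abs_continuous_on a b F" and neg: "negligible N"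
    and deriv: "\<And>t. t \<in> {a..b} - N \<Longrightarrow> (F has_vector_derivative f t) (at t within {a..b})"
  shows "(f has_integral (F b - F a)) {a..b}"
proof -
  \<comment> \<open>Changing \<open>f\<close> to \<open>0\<close> on the null set removes the values of \<open>f\<close> there from the Riemann sums.\<close>
  define g where "g t = (if t \<in> N then 0 else f t)" for t
  have "(g has_integral (F b - F a)) (cbox a b)"
    unfolding has_integral
  proof (intro allI impI)
    fix e :: real assume "0 < e"
    \<comment> \<open>The summand \<open>1\<close> covers \<open>a = b\<close> and makes the estimate below strict.\<close>
    define e1 where "e1 = e / 2 / (b - a + 1)"
    have "0 < e1" using \<open>0 < e\<close> \<open>a \<le> b\<close> by (simp add: e1_def)
    obtain \<delta> where "0 < \<delta>" and \<delta>: "\<And>D. \<lbrakk>D division_of \<Union>D; \<Union>D \<subseteq> {a..b}; (\<Sum>K\<in>D. Sup K - Inf K) < \<delta>\<rbrakk>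
        \<Longrightarrow> (\<Sum>K\<in>D. norm (F (Sup K) - F (Inf K))) < e / 2"
      using ac \<open>0 < e\<close> unfolding abs_continuous_on_def by (meson half_gt_zero)
    have "N \<in> sets lebesgue" using neg by (simp add: negligible_imp_sets)
    then obtain U where "open U" "N \<subseteq> U" "U - N \<in> lmeasurable" and U: "emeasure lebesgue (U - N) < ennreal \<delta>"
      using sets_lebesgue_outer_open[OF _ \<open>0 < \<delta>\<close>] by blast
    have null: "N \<in> null_sets lebesgue" using neg by (simp add: negligible_iff_null_sets)
    have Uset: "U \<in> sets lebesgue" using \<open>open U\<close> by simp
    have eU: "emeasure lebesgue U < ennreal \<delta>"
      using U emeasure_Diff_null_set[OF null Uset] by simp
    then have "U \<in> lmeasurable" using Uset by (intro fmeasurableI) (auto simp: less_top intro: less_trans)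
    have mU: "measure lebesgue U < \<delta>"
      using eU emeasure_eq_measure2[OF \<open>U \<in> lmeasurable\<close>] \<open>0 < \<delta>\<close> by (simp add: ennreal_less_iff)
    have "\<exists>d>0. \<forall>z\<in>{a..b}. norm (z - t) < d \<longrightarrow> norm (F z - F t - (z - t) *\<^sub>R f t) \<le> e1 * norm (z - t)"
      if "t \<in> {a..b} - N" for t
      using deriv[OF that] \<open>0 < e1\<close> unfolding has_vector_derivative_def has_derivative_within_alt by blast
    then obtain d where d: "\<And>t. t \<in> {a..b} - N \<Longrightarrow> 0 < d t"
      "\<And>t z. \<lbrakk>t \<in> {a..b} - N; z \<in> {a..b}; norm (z - t) < d t\<rbrakk>
          \<Longrightarrow> norm (F z - F t - (z - t) *\<^sub>R f t) \<le> e1 * norm (z - t)"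
      by metis
    define \<gamma> where "\<gamma> t = (if t \<in> N then U else if t \<in> {a..b} then ball t (d t) else UNIV)" for t
    have "gauge \<gamma>"
      using \<open>open U\<close> \<open>N \<subseteq> U\<close> d(1) by (auto simp: gauge_def \<gamma>_def)
    moreover have "norm ((\<Sum>(x,K)\<in>p. measure lborel K *\<^sub>R g x) - (F b - F a)) < e"
      if p: "p tagged_division_of cbox a b" "\<gamma> fine p" for p
    proof -
      have fin: "finite p" using p(1) by blast
      note pD = tagged_division_ofD[OF p(1)]
      define I where "I K = F (Sup K) - F (Inf K)" for K
      have ivl: "\<exists>u v. u \<le> x \<and> x \<le> v \<and> K = {u..v} \<and> {u..v} \<subseteq> {a..b}" if "(x,K) \<in> p" for x K
        using pD(2,3,4)[OF that] by (auto simp: box_real)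
      have tele: "(\<Sum>(x,K)\<in>p. I K) = F b - F a"
        using additive_tagged_division_1[OF \<open>a \<le> b\<close>, of p F] p(1) by (simp add: I_def box_real)
      define p1 p2 where "p1 = {(x,K)\<in>p. x \<in> N}" and "p2 = {(x,K)\<in>p. x \<notin> N}"
      have p12: "p1 \<subseteq> p" "p2 \<subseteq> p" "p = p1 \<union> p2" "p1 \<inter> p2 = {}" by (auto simp: p1_def p2_def)
      let ?h = "\<lambda>(x,K). norm (measure lborel K *\<^sub>R g x - I K)"
      have "(\<Sum>(x,K)\<in>p. measure lborel K *\<^sub>R g x) - (F b - F a) = (\<Sum>(x,K)\<in>p. measure lborel K *\<^sub>R g x - I K)"
        by (simp add: tele[symmetric] sum_subtractf case_prod_unfold)
      then have le_h: "norm ((\<Sum>(x,K)\<in>p. measure lborel K *\<^sub>R g x) - (F b - F a)) \<le> sum ?h p"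
        using norm_sum[of "\<lambda>(x,K). measure lborel K *\<^sub>R g x - I K" p] by (simp add: case_prod_unfold)
      have split_h: "sum ?h p = sum ?h p1 + sum ?h p2"
        unfolding p12(3)
        by (rule sum.union_disjoint[OF finite_subset[OF p12(1) fin] finite_subset[OF p12(2) fin] p12(4)])
      have "sum ?h p2 \<le> (\<Sum>(x,K)\<in>p2. e1 * measure lborel K)"
      proof (rule sum_mono, clarify)
        fix x K assume "(x,K) \<in> p2"
        then have xK: "(x,K) \<in> p" "x \<notin> N" by (auto simp: p2_def)
        then obtain u v where uv: "u \<le> x" "x \<le> v" "K = {u..v}" "{u..v} \<subseteq> {a..b}" using ivl by blast
        then have x: "x \<in> {a..b} - N" using xK by auto
        have "K \<subseteq> ball x (d x)" using fineD[OF p(2) xK(1)] x by (auto simp: \<gamma>_def)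
        moreover have "u \<in> K" "v \<in> K" using uv by auto
        ultimately have "u \<in> ball x (d x)" "v \<in> ball x (d x)" by blast+
        then have "norm (u - x) < d x" "norm (v - x) < d x" by (auto simp: dist_real_def)
        then have le: "norm (F u - F x - (u - x) *\<^sub>R f x) \<le> e1 * (x - u)"
          "norm (F v - F x - (v - x) *\<^sub>R f x) \<le> e1 * (v - x)"
          using d(2)[OF x, of u] d(2)[OF x, of v] uv by (auto simp: subset_iff)
        have eq: "(v - u) *\<^sub>R g x - I K = (F u - F x - (u - x) *\<^sub>R f x) - (F v - F x - (v - x) *\<^sub>R f x)"
          using uv xK by (simp add: I_def g_def algebra_simps scaleR_diff_left)
        have "norm ((v - u) *\<^sub>R g x - I K) \<le> e1 * (x - u) + e1 * (v - x)"
          unfolding eq by (rule order_trans[OF norm_triangle_ineq4 add_mono[OF le]])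
        then show "norm (measure lborel K *\<^sub>R g x - I K) \<le> e1 * measure lborel K"
          using uv by (simp add: algebra_simps)
      qed
      also have "\<dots> \<le> (\<Sum>(x,K)\<in>p. e1 * measure lborel K)"
        using fin p12(2) \<open>0 < e1\<close> by (intro sum_mono2) auto
      also have "\<dots> = e1 * (b - a)"
        using additive_content_tagged_division[OF p(1)] \<open>a \<le> b\<close>
        by (simp add: case_prod_unfold flip: sum_distrib_left)
      also have "\<dots> < e / 2"
        using \<open>0 < e\<close> \<open>a \<le> b\<close> by (simp add: e1_def field_simps)
      finally have h2: "sum ?h p2 < e / 2" .
      have h1: "sum ?h p1 < e / 2"
      proof -
        have p1: "p1 tagged_partial_division_of cbox a b"
          using p12(1) p(1) unfolding tagged_division_of_def
          by (blast intro: tagged_partial_division_subset)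
        have div: "snd ` p1 division_of \<Union>(snd ` p1)"
          by (rule partial_division_of_tagged_division[OF p1])
        have snd_ivl: "\<exists>u v. u \<le> v \<and> K = {u..v} \<and> {u..v} \<subseteq> {a..b}" if K: "K \<in> snd ` p1" for K
        proof -
          obtain x where "(x,K) \<in> p" using K p12(1) by auto
          then obtain u v where "u \<le> x" "x \<le> v" "K = {u..v}" "{u..v} \<subseteq> {a..b}" using ivl by blast
          then have "u \<le> v \<and> K = {u..v} \<and> {u..v} \<subseteq> {a..b}" by simp
          then show ?thesis by blast
        qed
        have snd_U: "K \<subseteq> U" if K: "K \<in> snd ` p1" for K
        proof -
          obtain x where "(x,K) \<in> p" "x \<in> N" using K by (auto simp: p1_def)
          then show ?thesis using fineD[OF p(2), of x K] by (simp add: \<gamma>_def)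
        qed
        have over: "(\<Sum>(x,K)\<in>p1. h K) = sum h (snd ` p1)"
          if "\<And>u v::real. \<lbrakk>box u v = {}; cbox u v \<noteq> {}\<rbrakk> \<Longrightarrow> h (cbox u v) = 0" for h :: "real set \<Rightarrow> real"
        proof -
          have ne: "K \<noteq> {}" if "K \<in> snd ` p1" for K
            using snd_ivl[OF that] by auto
          \<comment> \<open>Different tags can only share a degenerate interval, on which \<open>h\<close> vanishes; additivity over tagged
            divisions asks for the value \<open>0\<close> at the empty set as well.\<close>
          define h' where "h' K = (if K = {} then 0 else h K)" for K
          have "(\<Sum>(x,K)\<in>p1. h K) = (\<Sum>(x,K)\<in>p1. h' K)"
          proof (intro sum.cong refl, clarify)
            fix x K assume "(x,K) \<in> p1"
            then have "K \<in> snd ` p1" by force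
            then show "h K = h' K" using ne by (simp add: h'_def)
          qed
          also have "\<dots> = sum h' (snd ` p1)"
          proof (rule sum.over_tagged_division_lemma[OF tagged_partial_division_of_Union_self[OF p1]])
            fix u v :: real assume "box u v = {}"
            then show "h' (cbox u v) = 0" using that[of u v] unfolding h'_def by argo
          qed
          also have "\<dots> = sum h (snd ` p1)"
            using ne by (intro sum.cong) (auto simp: h'_def)
          finally show ?thesis .
        qed
        have "sum ?h p1 = (\<Sum>(x,K)\<in>p1. norm (I K))"
          by (intro sum.cong) (auto simp: p1_def g_def)
        also have "\<dots> = (\<Sum>K\<in>snd ` p1. norm (I K))"
        proof (rule over)
          fix u v :: real assume "box u v = {}" "cbox u v \<noteq> {}"
          then have "u = v" by simp
          show "norm (I (cbox u v)) = 0" unfolding \<open>u = v\<close> I_def by simp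
        qed
        also have "\<dots> < e / 2"
          unfolding I_def
        proof (rule \<delta>[OF div])
          show "\<Union>(snd ` p1) \<subseteq> {a..b}"
            using snd_ivl by blast
          have "(\<Sum>K\<in>snd ` p1. Sup K - Inf K) = (\<Sum>K\<in>snd ` p1. measure lebesgue K)"
          proof (intro sum.cong refl)
            fix K assume "K \<in> snd ` p1"
            then obtain u v where "u \<le> v" "K = {u..v}" using snd_ivl by blast
            then show "Sup K - Inf K = measure lebesgue K" by (simp only: cSup_atLeastAtMost) simp
          qed
          also have "\<dots> = measure lebesgue (\<Union>(snd ` p1))"
            by (rule content_division[OF div])
          also have "\<dots> \<le> measure lebesgue U"
          proof (rule measure_mono_fmeasurable[OF _ _ \<open>U \<in> lmeasurable\<close>])
            show "\<Union>(snd ` p1) \<subseteq> U"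
              by (rule Union_least[OF snd_U])
            show "\<Union>(snd ` p1) \<in> sets lebesgue"
              by (rule fmeasurableD[OF lmeasurable_division[OF div]])
          qed
          finally show "(\<Sum>K\<in>snd ` p1. Sup K - Inf K) < \<delta>"
            using mU by (rule order.strict_trans1)
        qed
        finally show ?thesis .
      qed
      have "sum ?h p < e"
        unfolding split_h using add_strict_mono[OF h1 h2] by (simp only: field_sum_of_halves)
      with le_h show ?thesis by (rule order.strict_trans1)
    qed
    ultimately show "\<exists>\<gamma>. gauge \<gamma> \<and> (\<forall>\<D>. \<D> tagged_division_of cbox a b \<and> \<gamma> fine \<D> \<longrightarrow>
        norm ((\<Sum>(x,K)\<in>\<D>. measure lborel K *\<^sub>R g x) - (F b - F a)) < e)"
      by (intro exI[of _ \<gamma>] conjI allI impI) (assumption, elim conjE)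
  qed
  then show ?thesis
    unfolding box_real by (rule has_integral_spike[OF neg, rotated]) (simp add: g_def)
qed

lemma abs_continuous_on_subset:
  assumes "abs_continuous_on a b F" "a \<le> c" "d \<le> b"
  shows "abs_continuous_on c d F"
  unfolding abs_continuous_on_def
proof (intro allI impI)
  fix e :: real assume "0 < e"
  then obtain \<delta> where \<delta>: "0 < \<delta>" "\<And>D. D division_of \<Union>D \<and> \<Union>D \<subseteq> {a..b} \<and> (\<Sum>K\<in>D. Sup K - Inf K) < \<delta>
      \<Longrightarrow> (\<Sum>K\<in>D. norm (F (Sup K) - F (Inf K))) < e"
    using assms(1) unfolding abs_continuous_on_def by blast
  have "{c..d} \<subseteq> {a..b}" using assms by auto
  then show "\<exists>\<delta>>0. \<forall>D. D division_of \<Union>D \<and> \<Union>D \<subseteq> {c..d} \<and> (\<Sum>K\<in>D. Sup K - Inf K) < \<delta> \<longrightarrow>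
      (\<Sum>K\<in>D. norm (F (Sup K) - F (Inf K))) < e"
    using \<delta> by (intro exI[of _ \<delta>]) (meson order_trans)
qed

lemma abs_continuous_on_imp_continuous_on:
  assumes "abs_continuous_on a b F"
  shows "continuous_on {a..b} F"
  unfolding continuous_on_iff
proof (intro ballI allI impI)
  fix x e :: real assume x: "x \<in> {a..b}" and "0 < e"
  then obtain \<delta> where \<delta>: "0 < \<delta>" "\<And>D. D division_of \<Union>D \<and> \<Union>D \<subseteq> {a..b} \<and> (\<Sum>K\<in>D. Sup K - Inf K) < \<delta>
      \<Longrightarrow> (\<Sum>K\<in>D. norm (F (Sup K) - F (Inf K))) < e"
    using assms unfolding abs_continuous_on_def by blast
  have "dist (F z) (F x) < e" if z: "z \<in> {a..b}" "dist z x < \<delta>" for z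
  proof -
    define u v where "u = min z x" and "v = max z x"
    have uv: "u \<le> v" "{u..v} \<subseteq> {a..b}" "v - u < \<delta>"
      using x z by (auto simp: u_def v_def dist_real_def)
    have "{cbox u v} division_of cbox u v"
      using uv(1) by (intro division_of_self) simp
    then have "norm (F v - F u) < e"
      using \<delta>(2)[of "{{u..v}}"] uv by simp
    then show ?thesis
      by (cases "z \<le> x") (auto simp: u_def v_def dist_norm norm_minus_commute)
  qed
  then show "\<exists>d>0. \<forall>z\<in>{a..b}. dist z x < d \<longrightarrow> dist (F z) (F x) < e"
    using \<delta>(1) by blast
qed

lemma abs_continuous_on_mult_lipschitz:
  assumes ac: "abs_continuous_on a b F"
    and lip: "\<And>u v. \<lbrakk>a \<le> u; u \<le> v; v \<le> b\<rbrakk> \<Longrightarrow> norm (g v - g u) \<le> L * (v - u)"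
    and gB: "\<And>t. t \<in> {a..b} \<Longrightarrow> norm (g t) \<le> B"
  shows "abs_continuous_on a b (\<lambda>t. g t * F t)"
proof -
  have "bounded (F ` {a..b})"
    by (intro compact_imp_bounded compact_continuous_image abs_continuous_on_imp_continuous_on[OF ac]) simp
  then obtain A where A: "0 < A" "\<And>t. t \<in> {a..b} \<Longrightarrow> norm (F t) \<le> A"
    unfolding bounded_pos by auto
  define B' where "B' = max 1 B"
  define L' where "L' = max 1 L"
  show ?thesis
    unfolding abs_continuous_on_def
  proof (intro allI impI)
    fix e :: real assume "0 < e"
    then have "0 < e / (2 * B')" by (simp add: B'_def)
    then obtain \<delta> where \<delta>: "0 < \<delta>" "\<And>D. D division_of \<Union>D \<and> \<Union>D \<subseteq> {a..b} \<and> (\<Sum>K\<in>D. Sup K - Inf K) < \<delta>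
        \<Longrightarrow> (\<Sum>K\<in>D. norm (F (Sup K) - F (Inf K))) < e / (2 * B')"
      using ac unfolding abs_continuous_on_def by blast
    have "(\<Sum>K\<in>D. norm (g (Sup K) * F (Sup K) - g (Inf K) * F (Inf K))) < e"
      if D: "D division_of \<Union>D" "\<Union>D \<subseteq> {a..b}" "(\<Sum>K\<in>D. Sup K - Inf K) < min \<delta> (e / (2 * (L' * A)))" for D
    proof -
      have term_le: "norm (g (Sup K) * F (Sup K) - g (Inf K) * F (Inf K))
          \<le> B' * norm (F (Sup K) - F (Inf K)) + L' * A * (Sup K - Inf K)" if K: "K \<in> D" for K
      proof -
        obtain u v where "K = cbox u v" "K \<noteq> {}" using division_ofD(3,4)[OF D(1) K] by blast
        then have uv: "u \<le> v" "K = {u..v}" by auto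
        have "{u..v} \<subseteq> {a..b}"
          unfolding uv(2)[symmetric] by (rule subset_trans[OF Union_upper[OF K] D(2)])
        then have ab: "u \<in> {a..b}" "v \<in> {a..b}" using uv(1) by simp_all
        have "g v * F v - g u * F u = g v * (F v - F u) + (g v - g u) * F u"
          by (simp add: algebra_simps)
        then have "norm (g v * F v - g u * F u) \<le> norm (g v) * norm (F v - F u) + norm (g v - g u) * norm (F u)"
          using norm_triangle_ineq[of "g v * (F v - F u)" "(g v - g u) * F u"] by (simp only: norm_mult)
        also have "\<dots> \<le> B' * norm (F v - F u) + (L' * (v - u)) * A"
        proof (intro add_mono mult_mono)
          show "norm (g v) \<le> B'" using gB[OF ab(2)] by (simp add: B'_def)
          have "norm (g v - g u) \<le> L * (v - u)" using lip ab uv by auto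
          also have "\<dots> \<le> L' * (v - u)" using uv by (intro mult_right_mono) (auto simp: L'_def)
          finally show "norm (g v - g u) \<le> L' * (v - u)" .
          show "norm (F u) \<le> A" by (rule A(2)[OF ab(1)])
        qed (use uv A in \<open>auto simp: B'_def L'_def\<close>)
        finally show ?thesis using uv by (simp add: mult_ac)
      qed
      have "(\<Sum>K\<in>D. norm (g (Sup K) * F (Sup K) - g (Inf K) * F (Inf K)))
          \<le> (\<Sum>K\<in>D. B' * norm (F (Sup K) - F (Inf K)) + L' * A * (Sup K - Inf K))"
        by (rule sum_mono[OF term_le])
      also have "\<dots> = B' * (\<Sum>K\<in>D. norm (F (Sup K) - F (Inf K))) + L' * A * (\<Sum>K\<in>D. Sup K - Inf K)"
        by (simp add: sum.distrib sum_distrib_left)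
      also have "\<dots> < B' * (e / (2 * B')) + L' * A * (e / (2 * (L' * A)))"
        using \<delta>(2)[of D] D A(1)
        by (intro add_strict_mono mult_strict_left_mono) (auto simp: B'_def L'_def)
      also have "\<dots> = e" using A(1) by (simp add: B'_def L'_def)
      finally show ?thesis .
    qed
    moreover have "0 < min \<delta> (e / (2 * (L' * A)))" using \<delta>(1) \<open>0 < e\<close> A(1) by (simp add: L'_def)
    ultimately show "\<exists>\<delta>>0. \<forall>D. D division_of \<Union>D \<and> \<Union>D \<subseteq> {a..b} \<and> (\<Sum>K\<in>D. Sup K - Inf K) < \<delta> \<longrightarrow>
        (\<Sum>K\<in>D. norm (g (Sup K) * F (Sup K) - g (Inf K) * F (Inf K))) < e"
      by (intro exI[of _ "min \<delta> (e / (2 * (L' * A)))"] conjI allI impI) (assumption, elim conjE)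
  qed
qed

lemma derivative_on_imp_continuous_on:
  assumes "derivative_on a b f f'"
  shows "continuous_on {a..b} f"
  using assms abs_continuous_on_imp_continuous_on unfolding derivative_on_def
  by (meson continuous_on_eq_continuous_within has_vector_derivative_continuous)

section \<open>The power kernel\<close>

text \<open>The kernel \<open>s powr \<nu>\<close>, extended by \<open>0\<close> to the negative half line.  With it the variable endpoint
of a fractional integral can be moved to a fixed one, as the kernel vanishes beyond the variable endpoint.\<close>
definition pos_powr :: "complex \<Rightarrow> real \<Rightarrow> complex" where
  "pos_powr \<nu> s = of_real (max 0 s) powr \<nu>"

lemma pos_powr_nonpos [simp]: "s \<le> 0 \<Longrightarrow> pos_powr \<nu> s = 0"
  by (simp add: pos_powr_def max_absorb1)

lemma pos_powr_eq: "0 \<le> s \<Longrightarrow> pos_powr \<nu> s = of_real s powr \<nu>"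
  by (simp add: pos_powr_def)

lemma pos_powr_max: "pos_powr \<nu> (max 0 s) = pos_powr \<nu> s"
  by (simp add: pos_powr_def)

lemma norm_pos_powr: "0 \<le> s \<Longrightarrow> norm (pos_powr \<nu> s) = s powr Re \<nu>"
  by (simp add: pos_powr_def norm_powr_real_powr)

lemma continuous_on_pos_powr:
  assumes "0 < Re \<nu>" shows "continuous_on S (pos_powr \<nu>)"
  unfolding pos_powr_def
  by (intro continuous_on_powr_complex continuous_intros) (use assms in auto)

lemma continuous_on_pos_powr_compose [continuous_intros]:
  assumes "0 < Re \<nu>" "continuous_on S g" shows "continuous_on S (\<lambda>t. pos_powr \<nu> (g t))"
  using continuous_on_compose2[OF continuous_on_pos_powr[OF assms(1)] assms(2)] by blast

lemma pos_powr_has_vector_derivative: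
  assumes "0 < s"
  shows "(pos_powr \<nu> has_vector_derivative \<nu> * of_real s powr (\<nu> - 1)) (at s)"
proof -
  have "((\<lambda>z. z powr \<nu>) has_field_derivative \<nu> * of_real s powr (\<nu> - 1)) (at (of_real s :: complex))"
    using assms by (intro has_field_derivative_powr) auto
  from has_vector_derivative_real_field[OF this]
  have "((\<lambda>s. of_real s powr \<nu>) has_vector_derivative \<nu> * of_real s powr (\<nu> - 1)) (at s)"
    by simp
  then show ?thesis
    by (rule has_vector_derivative_transform_within_open[of _ _ _ "{0<..}"])
       (use assms in \<open>auto simp: pos_powr_eq\<close>)
qed

text \<open>The derivative \<open>\<nu> * s powr (\<nu> - 1)\<close> is dominated in norm by a real multiple of the derivative of
\<open>s powr Re \<nu>\<close>, so complex increments are controlled by real ones.\<close>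
lemma norm_pos_powr_diff_le:
  assumes "0 < Re \<nu>" "0 \<le> s" "s \<le> s'"
  shows "norm (pos_powr \<nu> s' - pos_powr \<nu> s) \<le> norm \<nu> / Re \<nu> * (s' powr Re \<nu> - s powr Re \<nu>)"
proof (cases "s < s'")
  case True
  have "norm (pos_powr \<nu> s' - pos_powr \<nu> s)
      \<le> norm \<nu> / Re \<nu> * s' powr Re \<nu> - norm \<nu> / Re \<nu> * s powr Re \<nu>"
  proof (rule differentiable_bound_general[OF True])
    show "continuous_on {s..s'} (pos_powr \<nu>)" by (rule continuous_on_pos_powr[OF assms(1)])
    show "continuous_on {s..s'} (\<lambda>u. norm \<nu> / Re \<nu> * u powr Re \<nu>)"
      using assms by (intro continuous_intros continuous_on_powr') auto
    fix u assume u: "s < u" "u < s'"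
    then have "0 < u" using assms by linarith
    then show "(pos_powr \<nu> has_vector_derivative \<nu> * of_real u powr (\<nu> - 1)) (at u)"
      by (rule pos_powr_has_vector_derivative)
    have "((\<lambda>u. norm \<nu> / Re \<nu> * u powr Re \<nu>) has_real_derivative norm \<nu> * u powr (Re \<nu> - 1)) (at u)"
      using \<open>0 < u\<close> assms(1) by (auto intro!: derivative_eq_intros)
    then show "((\<lambda>u. norm \<nu> / Re \<nu> * u powr Re \<nu>) has_vector_derivative norm \<nu> * u powr (Re \<nu> - 1)) (at u)"
      by (simp add: has_real_derivative_iff_has_vector_derivative)
    show "norm (\<nu> * of_real u powr (\<nu> - 1)) \<le> norm \<nu> * u powr (Re \<nu> - 1)"
      using \<open>0 < u\<close> by (simp add: norm_mult norm_powr_real_powr)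
  qed
  then show ?thesis by (simp add: algebra_simps)
qed (use assms in auto)

text \<open>A bound for the difference quotients of \<open>s powr \<sigma>\<close> on \<open>{0..b}\<close> based at \<open>s\<close> that does not depend on
the other point.  For \<open>\<sigma> < 1\<close> it has to blow up at \<open>s = 0\<close>, but it remains integrable.\<close>
definition powr_slope_bound :: "real \<Rightarrow> real \<Rightarrow> real \<Rightarrow> real" where
  "powr_slope_bound \<sigma> b s = (if \<sigma> \<le> 1 then s powr (\<sigma> - 1) else \<sigma> * b powr (\<sigma> - 1))"

text \<open>For \<open>\<sigma> \<le> 1\<close> homogeneity reduces the claim to \<open>\<bar>r powr \<sigma> - 1\<bar> \<le> \<bar>r - 1\<bar>\<close> with \<open>r = s' / s\<close>, which holds
because \<open>r powr \<sigma>\<close> lies between \<open>r\<close> and \<open>1\<close>.  For \<open>\<sigma> > 1\<close> it is the mean value inequality.\<close>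
lemma abs_powr_diff_le:
  fixes \<sigma> s s' b :: real
  assumes "0 < \<sigma>" "0 < s" "s \<le> b" "0 \<le> s'" "s' \<le> b"
  shows "\<bar>s' powr \<sigma> - s powr \<sigma>\<bar> \<le> powr_slope_bound \<sigma> b s * \<bar>s' - s\<bar>"
proof (cases "\<sigma> \<le> 1")
  case True
  define r where "r = s' / s"
  have r: "0 \<le> r" "s' = r * s" using assms by (auto simp: r_def)
  have "\<bar>r powr \<sigma> - 1\<bar> \<le> \<bar>r - 1\<bar>"
  proof (cases "r \<le> 1")
    case True
    then have "r powr 1 \<le> r powr \<sigma>" "r powr \<sigma> \<le> 1"
      using r(1) \<open>\<sigma> \<le> 1\<close> \<open>0 < \<sigma>\<close> powr_mono'[of \<sigma> 1 r] powr_le1[of \<sigma> r] by simp_all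
    then show ?thesis using r by simp
  next
    case False
    then have "r powr \<sigma> \<le> r powr 1" "1 \<le> r powr \<sigma>"
      using \<open>\<sigma> \<le> 1\<close> \<open>0 < \<sigma>\<close> powr_mono[of \<sigma> 1 r] ge_one_powr_ge_zero[of r \<sigma>] by simp_all
    then show ?thesis using False by simp
  qed
  then have "s powr \<sigma> * \<bar>r powr \<sigma> - 1\<bar> \<le> s powr \<sigma> * \<bar>r - 1\<bar>"
    by (intro mult_left_mono) auto
  moreover have "s powr \<sigma> = s powr (\<sigma> - 1) * s"
    using assms by (simp add: powr_diff)
  moreover have "s' powr \<sigma> - s powr \<sigma> = s powr \<sigma> * (r powr \<sigma> - 1)"
    using r assms by (simp add: powr_mult algebra_simps)
  moreover have "s' - s = s * (r - 1)" using r by (simp add: algebra_simps)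
  ultimately show ?thesis
    using True assms by (simp add: powr_slope_bound_def abs_mult)
next
  case False
  have mono: "q powr \<sigma> - p powr \<sigma> \<le> \<sigma> * b powr (\<sigma> - 1) * (q - p)" "p powr \<sigma> \<le> q powr \<sigma>"
    if "0 \<le> p" "p \<le> q" "q \<le> b" for p q
  proof -
    have "norm (q powr \<sigma> - p powr \<sigma>) \<le> \<sigma> * b powr (\<sigma> - 1) * q - \<sigma> * b powr (\<sigma> - 1) * p" if "p < q"
    proof (rule differentiable_bound_general[OF that])
      show "continuous_on {p..q} (\<lambda>u. u powr \<sigma>)"
        using \<open>0 \<le> p\<close> \<open>0 < \<sigma>\<close> by (intro continuous_on_powr' continuous_intros) auto
      show "continuous_on {p..q} (\<lambda>u. \<sigma> * b powr (\<sigma> - 1) * u)" by (intro continuous_intros)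
      fix u assume u: "p < u" "u < q"
      then show "((\<lambda>u. u powr \<sigma>) has_vector_derivative \<sigma> * u powr (\<sigma> - 1)) (at u)"
        using \<open>0 \<le> p\<close> by (auto intro!: derivative_eq_intros simp flip: has_real_derivative_iff_has_vector_derivative)
      show "((\<lambda>u. \<sigma> * b powr (\<sigma> - 1) * u) has_vector_derivative \<sigma> * b powr (\<sigma> - 1)) (at u)"
        by (auto intro!: derivative_eq_intros simp flip: has_real_derivative_iff_has_vector_derivative)
      show "norm (\<sigma> * u powr (\<sigma> - 1)) \<le> \<sigma> * b powr (\<sigma> - 1)"
        using u \<open>0 \<le> p\<close> \<open>q \<le> b\<close> False by (auto simp: abs_mult intro!: powr_mono2)
    qed
    then show "q powr \<sigma> - p powr \<sigma> \<le> \<sigma> * b powr (\<sigma> - 1) * (q - p)"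
      using \<open>p \<le> q\<close> by (cases "p = q") (auto simp: algebra_simps)
    show "p powr \<sigma> \<le> q powr \<sigma>" using that(1) \<open>p \<le> q\<close> \<open>0 < \<sigma>\<close> by (intro powr_mono2) auto
  qed
  show ?thesis
    using mono[of s s'] mono[of s' s] assms False
    by (cases "s \<le> s'") (auto simp: powr_slope_bound_def)
qed

text \<open>The domination used when differentiating under the integral sign.  Here \<open>s'\<close> may be negative: replacing
it by \<open>0\<close> leaves the kernel unchanged and only decreases its distance to \<open>s\<close>.\<close>
lemma norm_pos_powr_diff_le_slope:
  assumes "0 < Re \<nu>" "0 < s" "s \<le> b" "s' \<le> b"
  shows "norm (pos_powr \<nu> s' - pos_powr \<nu> s)
      \<le> norm \<nu> / Re \<nu> * powr_slope_bound (Re \<nu>) b s * \<bar>s' - s\<bar>"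
proof -
  have "norm (pos_powr \<nu> (max 0 s') - pos_powr \<nu> s) \<le> norm \<nu> / Re \<nu> * \<bar>max 0 s' powr Re \<nu> - s powr Re \<nu>\<bar>"
  proof (cases "s \<le> max 0 s'")
    case True
    then have "s powr Re \<nu> \<le> max 0 s' powr Re \<nu>" using assms by (intro powr_mono2) auto
    then show ?thesis using norm_pos_powr_diff_le[of \<nu> s "max 0 s'"] assms True by simp
  next
    case False
    then have "max 0 s' powr Re \<nu> \<le> s powr Re \<nu>" using assms by (intro powr_mono2) auto
    then show ?thesis using norm_pos_powr_diff_le[of \<nu> "max 0 s'" s] assms False
      by (simp add: norm_minus_commute[of "pos_powr \<nu> (max 0 s')"])
  qed
  also have "\<dots> \<le> norm \<nu> / Re \<nu> * (powr_slope_bound (Re \<nu>) b s * \<bar>max 0 s' - s\<bar>)"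
    using assms by (intro mult_left_mono abs_powr_diff_le) auto
  also have "\<dots> \<le> norm \<nu> / Re \<nu> * (powr_slope_bound (Re \<nu>) b s * \<bar>s' - s\<bar>)"
    using assms by (intro mult_left_mono) (auto simp: powr_slope_bound_def)
  finally show ?thesis by (simp add: pos_powr_max algebra_simps)
qed

section \<open>Integrability against the kernel\<close>

lemma integrable_on_without_right_end:
  fixes g :: "real \<Rightarrow> 'a::euclidean_space"
  shows "g integrable_on {a..<x} \<longleftrightarrow> g integrable_on {a..x}"
  by (rule integrable_spike_set_eq) (rule negligible_subset[OF negligible_sing[of x]], auto)

lemma integral_without_right_end:
  fixes g :: "real \<Rightarrow> 'a::euclidean_space"
  shows "integral {a..<x} g = integral {a..x} g"
  by (rule integral_spike_set; rule negligible_subset[OF negligible_sing[of x]]) auto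

text \<open>The norm of the kernel is \<open>(x - t) powr (Re \<nu> - 1)\<close>, which has the continuous antiderivative
\<open>- (x - t) powr Re \<nu> / Re \<nu>\<close>.\<close>
lemma powr_kernel_absolutely_integrable:
  fixes \<nu> :: complex
  assumes "0 < Re \<nu>" "a \<le> x"
  shows "(\<lambda>t. of_real (x - t) powr (\<nu> - 1)) absolutely_integrable_on {a..x}"
proof -
  have "((\<lambda>t. (x - t) powr (Re \<nu> - 1)) has_integral (- ((x - x) powr Re \<nu> / Re \<nu>) - (- ((x - a) powr Re \<nu> / Re \<nu>)))) {a..x}"
  proof (rule fundamental_theorem_of_calculus_interior[OF \<open>a \<le> x\<close>])
    show "continuous_on {a..x} (\<lambda>t. - ((x - t) powr Re \<nu> / Re \<nu>))"
      using assms by (intro continuous_intros continuous_on_powr') auto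
    fix t assume "t \<in> {a<..<x}"
    then show "((\<lambda>t. - ((x - t) powr Re \<nu> / Re \<nu>)) has_vector_derivative (x - t) powr (Re \<nu> - 1)) (at t)"
      using assms by (auto intro!: derivative_eq_intros simp flip: has_real_derivative_iff_has_vector_derivative)
  qed
  then have int: "(\<lambda>t. (x - t) powr (Re \<nu> - 1)) integrable_on {a..<x}"
    unfolding integrable_on_without_right_end by (rule has_integral_integrable)
  have "(\<lambda>t. of_real (x - t) powr (\<nu> - 1)) absolutely_integrable_on {a..<x}"
  proof (rule measurable_bounded_by_integrable_imp_absolutely_integrable[OF _ _ int])
    show "(\<lambda>t. of_real (x - t) powr (\<nu> - 1)) \<in> borel_measurable (lebesgue_on {a..<x})"
      by (intro continuous_imp_measurable_on_sets_lebesgue continuous_on_powr_complex continuous_intros) auto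
    show "norm (of_real (x - t) powr (\<nu> - 1)) \<le> (x - t) powr (Re \<nu> - 1)" if "t \<in> {a..<x}" for t
      using that norm_powr_real_powr[of "of_real (x - t)" "\<nu> - 1"] by simp
  qed simp
  moreover have "(\<lambda>t. of_real (x - t) powr (\<nu> - 1)) absolutely_integrable_on {a..<x}
      \<longleftrightarrow> (\<lambda>t. of_real (x - t) powr (\<nu> - 1)) absolutely_integrable_on {a..x}"
    by (rule absolutely_integrable_spike_set_eq; rule negligible_subset[OF negligible_sing[of x]]; force)
  ultimately show ?thesis by blast
qed

text \<open>The condition under which the fractional integral of order \<open>\<nu>\<close> is defined.  Boundedness almost
everywhere is expressed with an explicit null set, the form in which the gauge integral consumes it.\<close>
definition admissible :: "complex \<Rightarrow> real set \<Rightarrow> (real \<Rightarrow> complex) \<Rightarrow> bool" where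
  "admissible \<nu> S f \<longleftrightarrow> f absolutely_integrable_on S \<and>
     (1 < Re \<nu> \<or> (\<exists>C N. negligible N \<and> (\<forall>t\<in>S - N. norm (f t) \<le> C)))"

lemma admissible_subset:
  assumes "admissible \<nu> S f" "T \<subseteq> S" "T \<in> sets lebesgue"
  shows "admissible \<nu> T f"
  using assms set_integrable_subset[of lebesgue S f T] unfolding admissible_def by blast

lemma continuous_mult_absolutely_integrable:
  fixes f g :: "real \<Rightarrow> complex"
  assumes "f absolutely_integrable_on {a..b}" "continuous_on {a..b} g"
  shows "(\<lambda>t. g t * f t) absolutely_integrable_on {a..b}"
  using assms
  by (intro absolutely_integrable_bounded_measurable_product[OF bilinear_times]
        continuous_imp_measurable_on_sets_lebesgue compact_imp_bounded compact_continuous_image) auto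

text \<open>One factor is bounded and the other integrable: for \<open>1 < Re \<nu>\<close> the kernel is continuous, otherwise
\<open>f\<close> is bounded up to a null set, on which it may be changed.\<close>
lemma powr_kernel_mult_absolutely_integrable:
  assumes "0 < Re \<nu>" "a \<le> x" and adm: "admissible \<nu> {a..x} f"
  shows "(\<lambda>t. of_real (x - t) powr (\<nu> - 1) * f t) absolutely_integrable_on {a..x}"
proof -
  have f: "f absolutely_integrable_on {a..x}" using adm by (simp add: admissible_def)
  show ?thesis
  proof (cases "1 < Re \<nu>")
    case True
    show ?thesis
    proof (rule continuous_mult_absolutely_integrable[OF f])
      have "continuous_on {a..x} (\<lambda>t. pos_powr (\<nu> - 1) (x - t))"
        using True by (intro continuous_intros) auto
      then show "continuous_on {a..x} (\<lambda>t. of_real (x - t) powr (\<nu> - 1))"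
        by (rule continuous_on_eq) (simp add: pos_powr_eq)
    qed
  next
    case False
    then obtain C N where N: "negligible N" "\<And>t. t \<in> {a..x} - N \<Longrightarrow> norm (f t) \<le> C"
      using adm unfolding admissible_def by blast
    define g where "g t = (if norm (f t) \<le> C then f t else 0)" for t
    have [measurable]: "f \<in> borel_measurable (lebesgue_on {a..x})"
      using f by (rule absolutely_integrable_imp_borel_measurable) simp
    have "g \<in> borel_measurable (lebesgue_on {a..x})"
      unfolding g_def by measurable
    moreover have "bounded (g ` {a..x})"
      unfolding bounded_iff by (intro exI[of _ "max 0 C"]) (auto simp: g_def)
    ultimately have "(\<lambda>t. g t * of_real (x - t) powr (\<nu> - 1)) absolutely_integrable_on {a..x}"
      by (intro absolutely_integrable_bounded_measurable_product[OF bilinear_times]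
            powr_kernel_absolutely_integrable assms) auto
    then show ?thesis
      by (rule absolutely_integrable_spike[OF _ N(1)]) (use N(2) in \<open>auto simp: g_def\<close>)
  qed
qed

lemma pos_powr_mult_absolutely_integrable:
  assumes "0 < Re \<nu>" "f absolutely_integrable_on {a..b}"
  shows "(\<lambda>t. pos_powr \<nu> (x - t) * f t) absolutely_integrable_on {a..b}"
  by (intro continuous_mult_absolutely_integrable continuous_intros assms)

text \<open>The dominating function for differentiation under the integral sign is integrable in both regimes:
for \<open>Re \<nu> \<le> 1\<close> it is the norm of the integrand of order \<open>\<nu>\<close>.\<close>
lemma slope_bound_mult_integrable:
  assumes "0 < Re \<nu>" "a \<le> x" and adm: "admissible \<nu> {a..x} f"
  shows "(\<lambda>t. powr_slope_bound (Re \<nu>) B (x - t) * norm (f t)) integrable_on {a..x}"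
proof (cases "Re \<nu> \<le> 1")
  case True
  have "(\<lambda>t. norm (of_real (x - t) powr (\<nu> - 1) * f t)) integrable_on {a..x}"
    using powr_kernel_mult_absolutely_integrable[OF assms] by (simp add: absolutely_integrable_on_def)
  then show ?thesis
    by (rule integrable_eq)
       (use True in \<open>auto simp: powr_slope_bound_def norm_mult norm_powr_real_powr\<close>)
next
  case False
  have "(\<lambda>t. norm (f t)) integrable_on {a..x}"
    using adm by (simp add: admissible_def absolutely_integrable_on_def)
  then show ?thesis using False
    by (auto simp: powr_slope_bound_def intro: integrable_on_mult_right)
qed

lemma Linf_on_imp_admissible:
  assumes "Linf_on a b f"
  shows "admissible \<nu> {a..b} f"
proof -
  obtain C where ae: "AE t in lebesgue. t \<in> {a..b} \<longrightarrow> norm (f t) \<le> C"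
    using assms unfolding Linf_on_def by blast
  define N where "N = {t. \<not> (t \<in> {a..b} \<longrightarrow> norm (f t) \<le> C)}"
  have N: "negligible N" using ae by (simp add: AE_lebesgue_iff_negligible N_def)
  have NC: "norm (f t) \<le> C" if "t \<in> {a..b} - N" for t using that by (simp add: N_def)
  have [measurable]: "f \<in> borel_measurable (lebesgue_on {a..b})"
    using assms unfolding Linf_on_def set_borel_measurable_def
    by (subst borel_measurable_restrict_space_iff) auto
  define g where "g t = (if norm (f t) \<le> C then f t else 0)" for t
  have "g absolutely_integrable_on {a..b}"
  proof (rule measurable_bounded_by_integrable_imp_absolutely_integrable)
    show "g \<in> borel_measurable (lebesgue_on {a..b})" unfolding g_def by measurable
    show "norm (g t) \<le> max 0 C" for t by (simp add: g_def le_max_iff_disj)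
  qed auto
  then have "f absolutely_integrable_on {a..b}"
    by (rule absolutely_integrable_spike[OF _ N]) (use NC in \<open>auto simp: g_def\<close>)
  then show ?thesis
    unfolding admissible_def using N NC by blast
qed

section \<open>Differentiating the incomplete kernel integral\<close>

lemma has_vector_derivative_within_iff_slope:
  fixes f :: "real \<Rightarrow> 'a::real_normed_vector"
  shows "(f has_vector_derivative D) (at x within S)
    \<longleftrightarrow> ((\<lambda>z. (f z - f x) /\<^sub>R (z - x)) \<longlongrightarrow> D) (at x within S)"
proof -
  have eq: "\<forall>\<^sub>F z in at x within S. norm ((1 / norm (z - x)) *\<^sub>R (f z - (f x + (z - x) *\<^sub>R D)))
      = norm ((f z - f x) /\<^sub>R (z - x) - D)"
    unfolding eventually_at_filter
  proof (intro always_eventually allI impI)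
    fix z assume "z \<noteq> x"
    then have "(f z - f x) /\<^sub>R (z - x) - D = (1 / (z - x)) *\<^sub>R ((f z - f x) - (z - x) *\<^sub>R D)"
      unfolding scaleR_diff_right scaleR_scaleR by (simp add: inverse_eq_divide)
    also have "\<dots> = (1 / (z - x)) *\<^sub>R (f z - (f x + (z - x) *\<^sub>R D))"
      by (simp add: diff_diff_eq)
    finally have "(f z - f x) /\<^sub>R (z - x) - D = (1 / (z - x)) *\<^sub>R (f z - (f x + (z - x) *\<^sub>R D))" .
    then show "norm ((1 / norm (z - x)) *\<^sub>R (f z - (f x + (z - x) *\<^sub>R D)))
        = norm ((f z - f x) /\<^sub>R (z - x) - D)" by simp
  qed
  have "(f has_vector_derivative D) (at x within S) \<longleftrightarrow>
      ((\<lambda>z. norm ((1 / norm (z - x)) *\<^sub>R (f z - (f x + (z - x) *\<^sub>R D)))) \<longlongrightarrow> 0) (at x within S)"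
    unfolding has_vector_derivative_def has_derivative_within tendsto_norm_zero_iff
    by (simp add: bounded_linear_scaleR_left)
  also have "\<dots> \<longleftrightarrow> ((\<lambda>z. norm ((f z - f x) /\<^sub>R (z - x) - D)) \<longlongrightarrow> 0) (at x within S)"
    by (rule tendsto_cong[OF eq])
  finally show ?thesis
    by (simp only: tendsto_norm_zero_iff LIM_zero_iff)
qed

text \<open>Differentiation under the integral sign with both limits fixed, by dominated convergence.  The
endpoint \<open>t = x\<close> is removed since the kernel need not be differentiable at \<open>0\<close>.\<close>
lemma kernel_integral_has_vector_derivative:
  assumes "0 < Re \<nu>" "a \<le> x" "x \<le> b" and adm: "admissible \<nu> {a..x} f"
  shows "((\<lambda>z. integral {a..x} (\<lambda>t. pos_powr \<nu> (z - t) * f t)) has_vector_derivative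
     \<nu> * integral {a..x} (\<lambda>t. of_real (x - t) powr (\<nu> - 1) * f t)) (at x within {..b})"
  unfolding has_vector_derivative_within_iff_slope tendsto_at_iff_sequentially o_def
proof (intro allI impI)
  fix X assume "\<forall>n. X n \<in> {..b} - {x}" and "X \<longlonglongrightarrow> x"
  then have X: "X n \<in> {..b} - {x}" for n by blast
  have f: "f absolutely_integrable_on {a..x}" using adm by (simp add: admissible_def)
  define q where "q n t = (pos_powr \<nu> (X n - t) - pos_powr \<nu> (x - t)) /\<^sub>R (X n - x) * f t" for n t
  have pint: "(\<lambda>t. pos_powr \<nu> (z - t) * f t) integrable_on {a..x}" for z
    using pos_powr_mult_absolutely_integrable[OF assms(1) f] by (simp add: set_lebesgue_integral_eq_integral)
  have q_eq: "q n = (\<lambda>t. (pos_powr \<nu> (X n - t) * f t - pos_powr \<nu> (x - t) * f t) /\<^sub>R (X n - x))" for n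
    by (simp add: q_def fun_eq_iff algebra_simps)
  have qint: "q n integrable_on {a..x}" for n
    unfolding q_eq by (intro integrable_cmul integrable_diff pint)
  have "(\<lambda>n. integral {a..<x} (q n)) \<longlonglongrightarrow> integral {a..<x} (\<lambda>t. \<nu> * of_real (x - t) powr (\<nu> - 1) * f t)"
  proof (rule dominated_convergence(2))
    show "q n integrable_on {a..<x}" for n unfolding integrable_on_without_right_end by (rule qint)
    show "(\<lambda>t. norm \<nu> / Re \<nu> * (powr_slope_bound (Re \<nu>) (b - a) (x - t) * norm (f t))) integrable_on {a..<x}"
      unfolding integrable_on_without_right_end
      by (intro integrable_on_mult_right slope_bound_mult_integrable assms)
    fix t assume t: "t \<in> {a..<x}"
    show "norm (q n t) \<le> norm \<nu> / Re \<nu> * (powr_slope_bound (Re \<nu>) (b - a) (x - t) * norm (f t))" for n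
    proof -
      have "X n \<noteq> x" using X[of n] by simp
      have "norm (pos_powr \<nu> (X n - t) - pos_powr \<nu> (x - t))
          \<le> norm \<nu> / Re \<nu> * powr_slope_bound (Re \<nu>) (b - a) (x - t) * \<bar>(X n - t) - (x - t)\<bar>"
        using t X[of n] assms by (intro norm_pos_powr_diff_le_slope) auto
      then have "inverse \<bar>X n - x\<bar> * norm (pos_powr \<nu> (X n - t) - pos_powr \<nu> (x - t))
          \<le> inverse \<bar>X n - x\<bar> * (norm \<nu> / Re \<nu> * powr_slope_bound (Re \<nu>) (b - a) (x - t) * \<bar>X n - x\<bar>)"
        by (intro mult_left_mono) auto
      also have "\<dots> = norm \<nu> / Re \<nu> * powr_slope_bound (Re \<nu>) (b - a) (x - t)"
        using \<open>X n \<noteq> x\<close> by simp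
      finally have "norm ((pos_powr \<nu> (X n - t) - pos_powr \<nu> (x - t)) /\<^sub>R (X n - x))
          \<le> norm \<nu> / Re \<nu> * powr_slope_bound (Re \<nu>) (b - a) (x - t)"
        unfolding norm_scaleR abs_inverse .
      then show ?thesis
        unfolding q_def norm_mult mult.assoc[symmetric] by (rule mult_right_mono) simp
    qed
    have "(pos_powr \<nu> has_vector_derivative \<nu> * of_real (x - t) powr (\<nu> - 1)) (at (x - t))"
      using t by (intro pos_powr_has_vector_derivative) auto
    then have lim: "((\<lambda>s. (pos_powr \<nu> s - pos_powr \<nu> (x - t)) /\<^sub>R (s - (x - t)))
        \<longlongrightarrow> \<nu> * of_real (x - t) powr (\<nu> - 1)) (at (x - t))"
      unfolding has_vector_derivative_within_iff_slope .
    have "(\<lambda>n. X n - t) \<longlonglongrightarrow> x - t" by (intro tendsto_intros \<open>X \<longlonglongrightarrow> x\<close>)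
    then have "filterlim (\<lambda>n. X n - t) (at (x - t)) sequentially"
      unfolding filterlim_at using X by (auto intro!: always_eventually)
    from filterlim_compose[OF lim this]
    have "(\<lambda>n. (pos_powr \<nu> (X n - t) - pos_powr \<nu> (x - t)) /\<^sub>R ((X n - t) - (x - t)))
        \<longlonglongrightarrow> \<nu> * of_real (x - t) powr (\<nu> - 1)" .
    then have "(\<lambda>n. q n t) \<longlonglongrightarrow> \<nu> * of_real (x - t) powr (\<nu> - 1) * f t"
      unfolding q_def by (intro tendsto_mult_right) simp
    then show "(\<lambda>n. q n t) \<longlonglongrightarrow> \<nu> * of_real (x - t) powr (\<nu> - 1) * f t" .
  qed
  moreover have "integral {a..<x} (q n) = (integral {a..x} (\<lambda>t. pos_powr \<nu> (X n - t) * f t)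
      - integral {a..x} (\<lambda>t. pos_powr \<nu> (x - t) * f t)) /\<^sub>R (X n - x)" for n
    unfolding q_eq integral_without_right_end by (simp add: integral_diff[OF pint pint])
  ultimately show "(\<lambda>n. (integral {a..x} (\<lambda>t. pos_powr \<nu> (X n - t) * f t)
      - integral {a..x} (\<lambda>t. pos_powr \<nu> (x - t) * f t)) /\<^sub>R (X n - x))
      \<longlonglongrightarrow> \<nu> * integral {a..x} (\<lambda>t. of_real (x - t) powr (\<nu> - 1) * f t)"
    by (simp add: integral_without_right_end mult.assoc)
qed

text \<open>The contribution of the moving upper limit: for \<open>z > x\<close> only \<open>{x..z}\<close> matters, and there the kernel is
at most \<open>(z - x) powr Re \<nu>\<close>.  If \<open>1 < Re \<nu>\<close> this alone is \<open>o(z - x)\<close>; otherwise \<open>f\<close> is bounded and the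
length of the interval supplies a further factor \<open>z - x\<close>.\<close>
lemma kernel_tail_has_vector_derivative:
  assumes "0 < Re \<nu>" "x \<le> b" and adm: "admissible \<nu> {x..b} f"
  shows "((\<lambda>z. integral {x..b} (\<lambda>t. pos_powr \<nu> (z - t) * f t)) has_vector_derivative 0) (at x within {..b})"
    (is "(?I has_vector_derivative 0) _")
proof -
  have f: "f absolutely_integrable_on {x..b}" using adm by (simp add: admissible_def)
  have pint: "(\<lambda>t. pos_powr \<nu> (z - t) * f t) integrable_on {x..b}" for z
    using pos_powr_mult_absolutely_integrable[OF assms(1) f] by (simp add: set_lebesgue_integral_eq_integral)
  have zero: "?I z = 0" if "z \<le> x" for z
    using that by (intro integral_unique has_integral_is_0) auto
  have norm_K: "norm (pos_powr \<nu> (z - t)) \<le> (z - x) powr Re \<nu>" if "x \<le> z" "x \<le> t" for z t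
  proof (cases "t \<le> z")
    case True
    then show ?thesis using that assms(1) by (auto simp: norm_pos_powr intro!: powr_mono2)
  qed simp
  \<comment> \<open>The surplus exponent \<open>p\<close> is \<open>Re \<nu> - 1\<close> for integrable and \<open>Re \<nu>\<close> for bounded \<open>f\<close>.\<close>
  obtain B p where "0 < p" and B: "\<And>z. \<lbrakk>x \<le> z; z \<le> b\<rbrakk> \<Longrightarrow> norm (?I z) \<le> B * (z - x) powr p * (z - x)"
  proof (cases "1 < Re \<nu>")
    case True
    show thesis
    proof (rule that[of "Re \<nu> - 1" "integral {x..b} (\<lambda>t. norm (f t))"])
      fix z assume z: "x \<le> z" "z \<le> b"
      have nf: "(\<lambda>t. norm (f t)) integrable_on {x..b}" using f by (simp add: absolutely_integrable_on_def)
      have "norm (?I z) \<le> integral {x..b} (\<lambda>t. (z - x) powr Re \<nu> * norm (f t))"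
        by (rule Henstock_Kurzweil_Integration.integral_norm_bound_integral[OF pint integrable_on_mult_right[OF nf]])
           (use z norm_K in \<open>auto simp: norm_mult intro!: mult_right_mono\<close>)
      also have "\<dots> = integral {x..b} (\<lambda>t. norm (f t)) * (z - x) powr (Re \<nu> - 1) * (z - x)"
        using z by (cases "z = x") (simp_all add: powr_diff)
      finally show "norm (?I z) \<le> integral {x..b} (\<lambda>t. norm (f t)) * (z - x) powr (Re \<nu> - 1) * (z - x)" .
    qed (use True in simp)
  next
    case False
    then obtain C N where N: "negligible N" "\<And>t. t \<in> {x..b} - N \<Longrightarrow> norm (f t) \<le> C"
      using adm unfolding admissible_def by blast
    show thesis
    proof (rule that[of "Re \<nu>" "max 0 C"])
      fix z assume z: "x \<le> z" "z \<le> b"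
      define g where "g t = (if t \<in> N then 0 else pos_powr \<nu> (z - t) * f t)" for t
      have int: "g integrable_on {x..b}"
        by (rule integrable_spike[OF pint[of z] N(1)]) (simp add: g_def)
      have "?I z = integral {x..b} g"
        by (rule integral_spike[OF N(1)]) (simp add: g_def)
      also have "\<dots> = integral {x..z} g + integral {z..b} g"
        by (rule Henstock_Kurzweil_Integration.integral_combine[symmetric, OF z int])
      also have "integral {z..b} g = 0"
        by (intro integral_unique has_integral_is_0) (simp add: g_def)
      finally have "norm (?I z) = norm (integral {x..z} g)" by simp
      also have "\<dots> \<le> integral {x..z} (\<lambda>t. max 0 C * (z - x) powr Re \<nu>)"
      proof (rule Henstock_Kurzweil_Integration.integral_norm_bound_integral)
        show "g integrable_on {x..z}" using z by (intro integrable_on_subinterval[OF int]) auto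
        fix t assume t: "t \<in> {x..z}"
        show "norm (g t) \<le> max 0 C * (z - x) powr Re \<nu>"
        proof (cases "t \<in> N")
          case False
          then have "norm (f t) \<le> max 0 C" using N(2)[of t] t z by auto
          then have "norm (f t) * norm (pos_powr \<nu> (z - t)) \<le> max 0 C * (z - x) powr Re \<nu>"
            using t z by (intro mult_mono norm_K) auto
          then show ?thesis using False by (simp add: g_def norm_mult mult.commute)
        qed (simp add: g_def)
      qed auto
      also have "\<dots> = max 0 C * (z - x) powr Re \<nu> * (z - x)" using z by simp
      finally show "norm (?I z) \<le> max 0 C * (z - x) powr Re \<nu> * (z - x)" .
    qed (use assms in simp)
  qed
  have "((\<lambda>z. B * \<bar>z - x\<bar> powr p) \<longlongrightarrow> B * \<bar>x - x\<bar> powr p) (at x within {..b})"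
    using \<open>0 < p\<close> by (intro tendsto_intros tendsto_powr') auto
  then have lim: "((\<lambda>z. B * \<bar>z - x\<bar> powr p) \<longlongrightarrow> 0) (at x within {..b})"
    using \<open>0 < p\<close> by simp
  show ?thesis
    unfolding has_vector_derivative_def has_derivative_within_alt2
  proof (intro conjI bounded_linear_scaleR_left allI impI)
    fix e :: real assume "0 < e"
    have "\<forall>\<^sub>F z in at x within {..b}. B * \<bar>z - x\<bar> powr p < e"
      using order_tendstoD(2)[OF lim \<open>0 < e\<close>] .
    moreover have "\<forall>\<^sub>F z in at x within {..b}. z \<le> b"
      by (simp add: eventually_at_filter)
    ultimately show "\<forall>\<^sub>F z in at x within {..b}. norm (?I z - ?I x - (z - x) *\<^sub>R 0) \<le> e * norm (z - x)"
    proof eventually_elim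
      case (elim z)
      show ?case
      proof (cases "x \<le> z")
        case True
        have "norm (?I z) \<le> B * (z - x) powr p * (z - x)" by (rule B[OF True elim(2)])
        also have "\<dots> \<le> e * (z - x)" using elim(1) True by (intro mult_right_mono) auto
        finally show ?thesis using True by (simp add: zero[of x])
      qed (use \<open>0 < e\<close> in \<open>simp add: zero\<close>)
    qed
  qed
qed

lemma norm_integral_diff_le:
  fixes f h :: "real \<Rightarrow> complex"
  assumes hf: "(\<lambda>t. h t * f t) integrable_on {a..b}" and nf: "(\<lambda>t. norm (f t)) integrable_on {a..b}"
    and uv: "u \<in> {a..b}" "v \<in> {a..b}" and le: "\<And>t. t \<in> {min u v..max u v} \<Longrightarrow> norm (h t) \<le> \<delta>"
  shows "norm (integral {a..v} (\<lambda>t. h t * f t) - integral {a..u} (\<lambda>t. h t * f t))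
      \<le> \<delta> * \<bar>integral {a..v} (\<lambda>t. norm (f t)) - integral {a..u} (\<lambda>t. norm (f t))\<bar>"
proof -
  have main: "norm (integral {a..q} (\<lambda>t. h t * f t) - integral {a..p} (\<lambda>t. h t * f t))
      \<le> \<delta> * \<bar>integral {a..q} (\<lambda>t. norm (f t)) - integral {a..p} (\<lambda>t. norm (f t))\<bar>"
    if pq: "a \<le> p" "p \<le> q" "q \<le> b" and le: "\<And>t. t \<in> {p..q} \<Longrightarrow> norm (h t) \<le> \<delta>" for p q
  proof -
    have split: "integral {a..q} g - integral {a..p} g = integral {p..q} g" if "g integrable_on {a..b}"
      for g :: "real \<Rightarrow> 'z::banach"
      using Henstock_Kurzweil_Integration.integral_combine[of a p q g] pq
        integrable_on_subinterval[OF that, of a q] by (auto simp: algebra_simps)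
    have sub: "g integrable_on {p..q}" if "g integrable_on {a..b}" for g :: "real \<Rightarrow> 'z::banach"
      using pq by (intro integrable_on_subinterval[OF that]) auto
    have "norm (integral {p..q} (\<lambda>t. h t * f t)) \<le> integral {p..q} (\<lambda>t. \<delta> * norm (f t))"
      by (rule Henstock_Kurzweil_Integration.integral_norm_bound_integral[OF sub[OF hf]
            integrable_on_mult_right[OF sub[OF nf]]])
         (use le in \<open>auto simp: norm_mult intro!: mult_right_mono\<close>)
    also have "\<dots> = \<delta> * \<bar>integral {p..q} (\<lambda>t. norm (f t))\<bar>"
      by (simp add: integral_nonneg sub[OF nf])
    finally show ?thesis by (simp add: split[OF hf] split[OF nf])
  qed
  show ?thesis
  proof (cases "u \<le> v")
    case True
    then show ?thesis using main[of u v] uv le by auto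
  next
    case False
    then show ?thesis using main[of v u] uv le by (auto simp: norm_minus_commute abs_minus_commute)
  qed
qed

text \<open>The contribution of the moving lower limit \<open>y * z\<close>.  Near \<open>y * x\<close> the kernel is close to the constant
\<open>k = pos_powr \<nu> (x - y * x)\<close>, for which the chain rule gives the value.  The remainder is \<open>o(z - x)\<close> because
the oscillation of the kernel tends to \<open>0\<close> while the integral of \<open>norm \<circ> f\<close> over the interval between
\<open>y * x\<close> and \<open>y * z\<close> is \<open>O(z - x)\<close>; this is what the differentiability of the second indefinite integral
provides.\<close>
lemma kernel_moving_limit_has_vector_derivative:
  assumes "0 < Re \<nu>" "0 < y" "y < 1" and x: "x \<in> {0..b}" and f: "f absolutely_integrable_on {0..b}"
    and M: "((\<lambda>u. integral {0..u} f) has_vector_derivative f (y * x)) (at (y * x) within {0..b})"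
    and N: "((\<lambda>u. integral {0..u} (\<lambda>t. norm (f t))) has_vector_derivative D) (at (y * x) within {0..b})"
  shows "((\<lambda>z. integral {0..y * z} (\<lambda>t. pos_powr \<nu> (z - t) * f t)
              - integral {0..y * x} (\<lambda>t. pos_powr \<nu> (z - t) * f t))
           has_vector_derivative of_real y * pos_powr \<nu> (x - y * x) * f (y * x)) (at x within {0..b})"
proof -
  let ?M = "\<lambda>u. integral {0..u} f" and ?N = "\<lambda>u. integral {0..u} (\<lambda>t. norm (f t))"
  define k where "k = pos_powr \<nu> (x - y * x)"
  define R where "R z = integral {0..y * z} (\<lambda>t. (pos_powr \<nu> (z - t) - k) * f t)
              - integral {0..y * x} (\<lambda>t. (pos_powr \<nu> (z - t) - k) * f t)" for z
  have fi: "f integrable_on {0..b}" and nf: "(\<lambda>t. norm (f t)) integrable_on {0..b}"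
    using f by (auto simp: absolutely_integrable_on_def)
  have pint: "(\<lambda>t. pos_powr \<nu> (z - t) * f t) integrable_on {0..b}" for z
    using pos_powr_mult_absolutely_integrable[OF assms(1) f] by (simp add: set_lebesgue_integral_eq_integral)
  have ymem: "y * z \<in> {0..b}" if "z \<in> {0..b}" for z
    using that assms(2,3) mult_left_le_one_le[of z y] by auto
  have Rint: "(\<lambda>t. (pos_powr \<nu> (z - t) - k) * f t) integrable_on {0..b}" for z
    unfolding left_diff_distrib by (intro integrable_diff pint integrable_on_mult_right fi)
  have R: "(R has_vector_derivative 0) (at x within {0..b})"
    unfolding has_vector_derivative_def has_derivative_within_alt
  proof (intro conjI bounded_linear_scaleR_left allI impI)
    fix e :: real assume "0 < e"
    \<comment> \<open>\<open>\<bar>D\<bar> + 1\<close> will be a Lipschitz constant at \<open>y * x\<close> for the indefinite integral of the norm.\<close>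
    define \<delta> where "\<delta> = e / (\<bar>D\<bar> + 1)"
    have "0 < \<delta>" using \<open>0 < e\<close> by (simp add: \<delta>_def)
    have "isCont (pos_powr \<nu>) (x - y * x)"
      using continuous_on_pos_powr[OF assms(1), of UNIV] by (simp add: continuous_on_eq_continuous_at)
    then obtain d1 where "0 < d1"
      and d1: "\<And>s. dist s (x - y * x) < d1 \<Longrightarrow> dist (pos_powr \<nu> s) k < \<delta>"
      unfolding continuous_at_eps_delta k_def using \<open>0 < \<delta>\<close> by blast
    have "\<exists>d>0. \<forall>w\<in>{0..b}. norm (w - y * x) < d \<longrightarrow>
        norm (?N w - ?N (y * x) - (w - y * x) *\<^sub>R D) \<le> 1 * norm (w - y * x)"
      using N unfolding has_vector_derivative_def has_derivative_within_alt by (meson zero_less_one)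
    then obtain d2 where "0 < d2" and d2: "\<And>w. \<lbrakk>w \<in> {0..b}; norm (w - y * x) < d2\<rbrakk>
        \<Longrightarrow> norm (?N w - ?N (y * x) - (w - y * x) *\<^sub>R D) \<le> 1 * norm (w - y * x)"
      by blast
    show "\<exists>d>0. \<forall>z\<in>{0..b}. norm (z - x) < d \<longrightarrow> norm (R z - R x - (z - x) *\<^sub>R 0) \<le> e * norm (z - x)"
    proof (intro exI conjI ballI impI)
      show "0 < min (d1 / 2) d2" using \<open>0 < d1\<close> \<open>0 < d2\<close> by simp
      fix z assume z: "z \<in> {0..b}" "norm (z - x) < min (d1 / 2) d2"
      have yz: "\<bar>y * z - y * x\<bar> \<le> \<bar>z - x\<bar>"
        using assms(2,3) mult_left_le_one_le[of "\<bar>z - x\<bar>" y]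
        by (simp add: abs_mult flip: right_diff_distrib)
      then have "\<bar>?N (y * z) - ?N (y * x) - (y * z - y * x) * D\<bar> \<le> \<bar>y * z - y * x\<bar>"
        using d2[OF ymem[OF z(1)]] z(2) by simp
      then have "\<bar>?N (y * z) - ?N (y * x)\<bar> \<le> \<bar>y * z - y * x\<bar> + \<bar>(y * z - y * x) * D\<bar>"
        by linarith
      also have "\<dots> = \<bar>y * z - y * x\<bar> + \<bar>D\<bar> * \<bar>y * z - y * x\<bar>"
        unfolding abs_mult by (simp only: mult.commute)
      also have "\<dots> = (\<bar>D\<bar> + 1) * \<bar>y * z - y * x\<bar>" by (simp add: distrib_right)
      also have "\<dots> \<le> (\<bar>D\<bar> + 1) * \<bar>z - x\<bar>" using yz by (intro mult_left_mono) auto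
      finally have Nle: "\<bar>?N (y * z) - ?N (y * x)\<bar> \<le> (\<bar>D\<bar> + 1) * \<bar>z - x\<bar>" .
      have "norm (R z) \<le> \<delta> * \<bar>?N (y * z) - ?N (y * x)\<bar>"
        unfolding R_def
      proof (rule norm_integral_diff_le[OF Rint nf ymem[OF x] ymem[OF z(1)]])
        fix t assume "t \<in> {min (y * x) (y * z)..max (y * x) (y * z)}"
        then have tx: "\<bar>t - y * x\<bar> \<le> \<bar>z - x\<bar>" using yz by (auto simp: min_def max_def split: if_splits)
        have "dist (z - t) (x - y * x) = \<bar>(z - x) - (t - y * x)\<bar>"
          by (simp add: dist_real_def)
        also have "\<dots> \<le> \<bar>z - x\<bar> + \<bar>t - y * x\<bar>" by (rule abs_triangle_ineq4)
        also have "\<dots> \<le> \<bar>z - x\<bar> + \<bar>z - x\<bar>" by (rule add_left_mono[OF tx])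
        also have "\<dots> < d1" using z(2) by simp
        finally have "dist (z - t) (x - y * x) < d1" .
        then show "norm (pos_powr \<nu> (z - t) - k) \<le> \<delta>" using d1 by (simp add: dist_norm less_imp_le)
      qed
      also have "\<dots> \<le> \<delta> * ((\<bar>D\<bar> + 1) * \<bar>z - x\<bar>)"
        using Nle \<open>0 < \<delta>\<close> by (intro mult_left_mono) auto
      also have "\<dots> = e * \<bar>z - x\<bar>"
        using abs_ge_zero[of D] by (simp add: \<delta>_def add_nonneg_eq_0_iff)
      finally show "norm (R z - R x - (z - x) *\<^sub>R 0) \<le> e * norm (z - x)"
        by (simp add: R_def)
    qed
  qed
  have "((\<lambda>z. y * z) has_vector_derivative y) (at x within {0..b})"
    by (auto intro!: derivative_eq_intros)
  moreover have "(?M has_vector_derivative f (y * x)) (at (y * x) within (\<lambda>z. y * z) ` {0..b})"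
    using ymem by (intro has_vector_derivative_within_subset[OF M]) auto
  ultimately have "(?M \<circ> (\<lambda>z. y * z) has_vector_derivative y *\<^sub>R f (y * x)) (at x within {0..b})"
    by (rule vector_diff_chain_within)
  then have "((\<lambda>z. k * (?M (y * z) - ?M (y * x)) + R z) has_vector_derivative
      k * (y *\<^sub>R f (y * x) - 0) + 0) (at x within {0..b})"
    unfolding o_def
    by (intro has_vector_derivative_add R has_vector_derivative_mult_right has_vector_derivative_diff
         has_vector_derivative_const)
  moreover have "k * (?M (y * z) - ?M (y * x)) + R z = integral {0..y * z} (\<lambda>t. pos_powr \<nu> (z - t) * f t)
              - integral {0..y * x} (\<lambda>t. pos_powr \<nu> (z - t) * f t)" if "z \<in> {0..b}" for z
  proof -
    have "integral {0..w} (\<lambda>t. (pos_powr \<nu> (z - t) - k) * f t)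
        = integral {0..w} (\<lambda>t. pos_powr \<nu> (z - t) * f t) - k * ?M w" if "w \<in> {0..b}" for w
      unfolding left_diff_distrib using that
      by (subst integral_diff) (auto intro!: integrable_on_mult_right
            intro: integrable_on_subinterval[OF pint] integrable_on_subinterval[OF fi])
    then show ?thesis using ymem[OF that] ymem[OF x] by (simp add: R_def algebra_simps)
  qed
  ultimately have "((\<lambda>z. integral {0..y * z} (\<lambda>t. pos_powr \<nu> (z - t) * f t)
              - integral {0..y * x} (\<lambda>t. pos_powr \<nu> (z - t) * f t))
           has_vector_derivative k * (y *\<^sub>R f (y * x) - 0) + 0) (at x within {0..b})"
    using has_vector_derivative_transform[OF x] by (metis (no_types, lifting))
  then show ?thesis by (simp add: k_def scaleR_conv_of_real mult_ac)
qed

text \<open>Since the kernel vanishes beyond \<open>z\<close>, the integral over \<open>{y * z..z}\<close> is the one over \<open>{y * z..b}\<close>.  Splitting it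
at the fixed points \<open>y * x\<close> and \<open>x\<close> leaves the three pieces differentiated above.\<close>
theorem incomplete_kernel_integral_has_vector_derivative:
  assumes "0 < Re \<nu>" "0 < y" "y < 1" and x: "x \<in> {0..b}" and adm: "admissible \<nu> {0..b} f"
    and M: "((\<lambda>u. integral {0..u} f) has_vector_derivative f (y * x)) (at (y * x) within {0..b})"
    and N: "((\<lambda>u. integral {0..u} (\<lambda>t. norm (f t))) has_vector_derivative D) (at (y * x) within {0..b})"
  shows "((\<lambda>z. integral {y * z..z} (\<lambda>t. pos_powr \<nu> (z - t) * f t)) has_vector_derivative
     - (of_real y * pos_powr \<nu> (x - y * x) * f (y * x))
     + \<nu> * integral {y * x..x} (\<lambda>t. of_real (x - t) powr (\<nu> - 1) * f t)) (at x within {0..b})"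
proof -
  define J where "J z p q = integral {p..q} (\<lambda>t. pos_powr \<nu> (z - t) * f t)" for z p q
  have f: "f absolutely_integrable_on {0..b}" using adm by (simp add: admissible_def)
  have yle: "0 \<le> y * z" "y * z \<le> z" if "z \<in> {0..b}" for z
    using that assms(2,3) mult_left_le_one_le[of z y] by auto
  have pint: "(\<lambda>t. pos_powr \<nu> (z - t) * f t) integrable_on {p..q}" if "0 \<le> p" "q \<le> b" for z p q
    using that pos_powr_mult_absolutely_integrable[OF assms(1), where f=f and a=p and b=q and x=z] set_integrable_subset[OF f, of "{p..q}"]
    by (auto simp: set_lebesgue_integral_eq_integral)
  have comb: "J z p q + J z q r = J z p r" if "0 \<le> p" "p \<le> q" "q \<le> r" "r \<le> b" for z p q r
    unfolding J_def using that
    by (intro Henstock_Kurzweil_Integration.integral_combine pint) auto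
  have "((\<lambda>z. J z (y * x) x) has_vector_derivative
      \<nu> * integral {y * x..x} (\<lambda>t. of_real (x - t) powr (\<nu> - 1) * f t)) (at x within {0..b})"
    unfolding J_def using yle[OF x] x
    by (intro has_vector_derivative_within_subset[OF kernel_integral_has_vector_derivative[where b=b]]
         admissible_subset[OF adm] assms(1)) auto
  moreover have "((\<lambda>z. J z x b) has_vector_derivative 0) (at x within {0..b})"
    unfolding J_def using x
    by (intro has_vector_derivative_within_subset[OF kernel_tail_has_vector_derivative]
         admissible_subset[OF adm] assms(1)) auto
  moreover have "((\<lambda>z. J z 0 (y * z) - J z 0 (y * x)) has_vector_derivative
      of_real y * pos_powr \<nu> (x - y * x) * f (y * x)) (at x within {0..b})"
    unfolding J_def by (rule kernel_moving_limit_has_vector_derivative[OF assms(1-3) x f M N])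
  ultimately have der: "((\<lambda>z. J z (y * x) x + J z x b - (J z 0 (y * z) - J z 0 (y * x))) has_vector_derivative
      \<nu> * integral {y * x..x} (\<lambda>t. of_real (x - t) powr (\<nu> - 1) * f t) + 0
        - of_real y * pos_powr \<nu> (x - y * x) * f (y * x)) (at x within {0..b})"
    by (intro has_vector_derivative_diff has_vector_derivative_add)
  have eq: "J z (y * x) x + J z x b - (J z 0 (y * z) - J z 0 (y * x)) = J z (y * z) z" if z: "z \<in> {0..b}" for z
  proof -
    have "J z z b = 0"
      unfolding J_def by (intro integral_unique has_integral_is_0) auto
    moreover have "J z (y * x) x + J z x b = J z (y * x) b" "J z 0 (y * x) + J z (y * x) b = J z 0 b"
      using yle[OF x] x by (auto intro!: comb)
    moreover have "J z 0 (y * z) + J z (y * z) b = J z 0 b" "J z (y * z) z + J z z b = J z (y * z) b"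
      using yle[OF z] z by (auto intro!: comb)
    ultimately show ?thesis by (simp add: algebra_simps)
  qed
  have "((\<lambda>z. J z (y * z) z) has_vector_derivative
      \<nu> * integral {y * x..x} (\<lambda>t. of_real (x - t) powr (\<nu> - 1) * f t) + 0
        - of_real y * pos_powr \<nu> (x - y * x) * f (y * x)) (at x within {0..b})"
    by (rule has_vector_derivative_transform[OF x _ der]) (simp add: eq)
  then show ?thesis unfolding J_def by simp
qed

section \<open>Integration by parts against the kernel\<close>

text \<open>The product \<open>P\<close> of the kernel and \<open>f\<close> is continuous up to \<open>x\<close>, where it vanishes, so the claim is the
fundamental theorem of calculus for \<open>P\<close>.  If \<open>f\<close> is differentiable everywhere, the version for derivatives in the
interior applies.  If \<open>f\<close> is absolutely continuous, so is \<open>P\<close> on every \<open>{a..d}\<close> with \<open>d < x\<close>, where the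
kernel is Lipschitz, and both sides are continuous as \<open>d\<close> tends to \<open>x\<close>.\<close>
theorem kernel_integration_by_parts:
  assumes "0 < Re \<nu>" "a \<le> x" and der: "derivative_on a x f f'" and f': "f' absolutely_integrable_on {a..x}"
  shows "integral {a..x} (\<lambda>t. pos_powr \<nu> (x - t) * f' t)
    = - (pos_powr \<nu> (x - a) * f a) + \<nu> * integral {a..x} (\<lambda>t. of_real (x - t) powr (\<nu> - 1) * f t)"
proof -
  define k where "k t = of_real (x - t) powr (\<nu> - 1)" for t
  define p where "p t = pos_powr \<nu> (x - t) * f' t - \<nu> * (k t * f t)" for t
  define P where "P t = pos_powr \<nu> (x - t) * f t" for t
  have contf: "continuous_on {a..x} f" by (rule derivative_on_imp_continuous_on[OF der])
  have contP: "continuous_on {a..x} P"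
    unfolding P_def by (intro continuous_intros contf assms(1))
  have "admissible \<nu> {a..x} f"
  proof -
    have "bounded (f ` {a..x})" by (intro compact_imp_bounded compact_continuous_image contf) simp
    then obtain C where "\<forall>t\<in>{a..x}. norm (f t) \<le> C" unfolding bounded_iff by auto
    then show ?thesis
      unfolding admissible_def using absolutely_integrable_continuous_real[OF contf]
      by (blast intro: negligible_empty)
  qed
  then have kint: "(\<lambda>t. k t * f t) integrable_on {a..x}"
    using powr_kernel_mult_absolutely_integrable[OF assms(1,2)]
    by (simp add: k_def set_lebesgue_integral_eq_integral)
  have pint: "(\<lambda>t. pos_powr \<nu> (x - t) * f' t) integrable_on {a..x}"
    using pos_powr_mult_absolutely_integrable[OF assms(1) f'] by (simp add: set_lebesgue_integral_eq_integral)
  have p_int: "p integrable_on {a..x}"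
    unfolding p_def by (intro integrable_diff pint integrable_on_mult_right kint)
  have derK: "((\<lambda>t. pos_powr \<nu> (x - t)) has_vector_derivative - (\<nu> * k t)) (at t within S)" if "t < x" for t S
  proof -
    have "((\<lambda>t. x - t) has_vector_derivative - 1) (at t within S)"
      by (auto intro!: derivative_eq_intros)
    moreover have "(pos_powr \<nu> has_vector_derivative \<nu> * k t) (at (x - t) within (\<lambda>t. x - t) ` S)"
      unfolding k_def
      by (rule has_vector_derivative_at_within, rule pos_powr_has_vector_derivative) (use that in simp)
    ultimately have "(pos_powr \<nu> \<circ> (\<lambda>t. x - t) has_vector_derivative (- 1) *\<^sub>R (\<nu> * k t)) (at t within S)"
      by (rule vector_diff_chain_within)
    then show ?thesis by (simp add: o_def)
  qed
  have derP: "(P has_vector_derivative p t) (at t within S)"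
    if "t < x" "(f has_vector_derivative f' t) (at t within S)" for t S
    unfolding P_def using has_vector_derivative_mult[OF derK[OF that(1)] that(2)]
    by (simp add: p_def algebra_simps)
  have "(p has_integral (P x - P a)) {a..x}"
    using der unfolding derivative_on_def
  proof
    assume cl: "\<forall>t\<in>{a..x}. (f has_vector_derivative f' t) (at t within {a..x})"
    show ?thesis
    proof (rule fundamental_theorem_of_calculus_interior[OF \<open>a \<le> x\<close> contP])
      fix t assume t: "t \<in> {a<..<x}"
      then have "(P has_vector_derivative p t) (at t within {a..x})" using cl by (intro derP) auto
      then show "(P has_vector_derivative p t) (at t)"
        using t by (simp add: at_within_Icc_at)
    qed
  next
    assume "abs_continuous_on a x f \<and>
      (AE t\<in>{a..x} in lebesgue. (f has_vector_derivative f' t) (at t within {a..x}))"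
    then have ac: "abs_continuous_on a x f"
      and neg: "negligible {t. \<not> (t \<in> {a..x} \<longrightarrow> (f has_vector_derivative f' t) (at t within {a..x}))}"
      by (auto simp: AE_lebesgue_iff_negligible)
    define N where "N = {t. \<not> (t \<in> {a..x} \<longrightarrow> (f has_vector_derivative f' t) (at t within {a..x}))}"
    have derf: "(f has_vector_derivative f' t) (at t within {a..x})" if "t \<in> {a..x} - N" for t
      using that by (simp add: N_def)
    have below: "integral {a..d} p = P d - P a" if d: "a \<le> d" "d < x" for d
    proof (rule integral_unique, rule has_integral_derivative_abs_continuous[OF d(1) _ neg[folded N_def]])
      show "(P has_vector_derivative p t) (at t within {a..d})" if "t \<in> {a..d} - N" for t
        using that d by (intro derP has_vector_derivative_within_subset[OF derf]) auto
      show "abs_continuous_on a d P"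
        unfolding P_def
      proof (rule abs_continuous_on_mult_lipschitz)
        show "abs_continuous_on a d f" using ac d by (intro abs_continuous_on_subset[OF ac]) auto
        \<comment> \<open>The slope bound at distance at least \<open>x - d\<close> from the singularity; as a function of the distance it is
          non-increasing for \<open>Re \<nu> \<le> 1\<close> and constant otherwise.\<close>
        define L where "L = norm \<nu> / Re \<nu> * (if Re \<nu> \<le> 1 then (x - d) powr (Re \<nu> - 1) else Re \<nu> * (x - a) powr (Re \<nu> - 1))"
        show "norm (pos_powr \<nu> (x - v) - pos_powr \<nu> (x - u)) \<le> L * (v - u)" if "a \<le> u" "u \<le> v" "v \<le> d" for u v
        proof -
          have "norm (pos_powr \<nu> (x - v) - pos_powr \<nu> (x - u))
              \<le> norm \<nu> / Re \<nu> * powr_slope_bound (Re \<nu>) (x - a) (x - u) * \<bar>(x - v) - (x - u)\<bar>"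
            using that d assms(1) by (intro norm_pos_powr_diff_le_slope) auto
          also have "\<dots> \<le> L * (v - u)"
            using that d assms(1) unfolding L_def
            by (intro mult_mono) (auto simp: powr_slope_bound_def intro!: divide_right_mono mult_left_mono powr_mono2')
          finally show ?thesis .
        qed
        show "norm (pos_powr \<nu> (x - t)) \<le> (x - a) powr Re \<nu>" if "t \<in> {a..d}" for t
          using that d assms(1) by (auto simp: norm_pos_powr intro!: powr_mono2)
      qed
    qed
    have "integral {a..x} p = P x - P a"
    proof (cases "a = x")
      case False
      then have "a < x" using \<open>a \<le> x\<close> by simp
      have lim: "((\<lambda>d. integral {a..d} p) \<longlongrightarrow> integral {a..x} p) (at x within {a..x})"
        using indefinite_integral_continuous_1[OF p_int] \<open>a \<le> x\<close> by (simp add: continuous_on_def)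
      have "(P \<longlongrightarrow> P x) (at x within {a..x})"
        using contP \<open>a \<le> x\<close> by (simp add: continuous_on_def)
      then have "((\<lambda>d. P d - P a) \<longlongrightarrow> P x - P a) (at x within {a..x})"
        by (intro tendsto_diff tendsto_const)
      moreover have "\<forall>\<^sub>F d in at x within {a..x}. P d - P a = integral {a..d} p"
        by (auto simp: eventually_at_filter below)
      ultimately have "((\<lambda>d. integral {a..d} p) \<longlongrightarrow> P x - P a) (at x within {a..x})"
        by (rule Lim_transform_eventually)
      moreover have "at x within {a..x} \<noteq> bot"
        using \<open>a < x\<close> by (simp add: trivial_limit_within islimpt_Icc)
      ultimately show ?thesis
        using lim by (intro tendsto_unique)
    qed simp
    then show ?thesis using p_int integrable_integral by metis
  qed
  then have "integral {a..x} p = - (pos_powr \<nu> (x - a) * f a)"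
    by (simp add: integral_unique P_def)
  moreover have "integral {a..x} p = integral {a..x} (\<lambda>t. pos_powr \<nu> (x - t) * f' t)
      - \<nu> * integral {a..x} (\<lambda>t. k t * f t)"
    unfolding p_def by (simp add: integral_diff pint kint integrable_on_mult_right)
  ultimately show ?thesis by (simp add: k_def algebra_simps)
qed

section \<open>The incomplete Riemann--Liouville integral\<close>

lemma RL_upper_eq_pos_powr:
  assumes "0 < Re \<nu>" "h absolutely_integrable_on {y * x..x}"
  shows "RL_upper y (\<nu> + 1) h x = integral {y * x..x} (\<lambda>t. pos_powr \<nu> (x - t) * h t) / Gamma (\<nu> + 1)"
proof -
  have "set_lebesgue_integral lebesgue {y * x..x} (\<lambda>t. of_real (x - t) powr \<nu> * h t)
      = set_lebesgue_integral lebesgue {y * x..x} (\<lambda>t. pos_powr \<nu> (x - t) * h t)"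
    by (rule set_lebesgue_integral_cong) (auto simp: pos_powr_eq)
  also have "\<dots> = integral {y * x..x} (\<lambda>t. pos_powr \<nu> (x - t) * h t)"
    by (rule set_lebesgue_integral_eq_integral(2)[OF pos_powr_mult_absolutely_integrable[OF assms]])
  finally show ?thesis by (simp add: RL_upper_def)
qed

lemma RL_upper_eq_integral:
  assumes "0 < Re \<nu>" "y * x \<le> x" "admissible \<nu> {y * x..x} h"
  shows "RL_upper y \<nu> h x = integral {y * x..x} (\<lambda>t. of_real (x - t) powr (\<nu> - 1) * h t) / Gamma \<nu>"
  unfolding RL_upper_def
  by (subst set_lebesgue_integral_eq_integral(2)[OF powr_kernel_mult_absolutely_integrable[OF assms]]) simp

lemma RL_upper_boundary_coefficient:
  assumes "0 \<le> x" "y \<le> 1"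
  shows "pos_powr \<nu> (x - y * x) = of_real (1 - y) powr \<nu> * of_real x powr \<nu>"
proof -
  have "y * x \<le> x" using mult_right_mono[of y 1 x] assms by simp
  have "pos_powr \<nu> (x - y * x) = (of_real (1 - y) * of_real x) powr \<nu>"
    using \<open>y * x \<le> x\<close> by (simp add: pos_powr_eq left_diff_distrib)
  also have "\<dots> = of_real (1 - y) powr \<nu> * of_real x powr \<nu>"
    using assms by (intro powr_times_real Reals_of_real) simp_all
  finally show ?thesis .
qed

lemma Gamma_shift_quotient:
  fixes \<nu> :: complex
  assumes "0 < Re \<nu>"
  shows "\<nu> * I / Gamma (\<nu> + 1) = I / Gamma \<nu>"
proof -
  have "\<nu> \<notin> \<int>\<^sub>\<le>\<^sub>0" using assms by (auto elim!: nonpos_Ints_cases)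
  moreover have "\<nu> \<noteq> 0" using assms by auto
  ultimately show ?thesis by (simp add: Gamma_plus1)
qed

theorem RL_upper_has_vector_derivative:
  assumes "0 < y" "y < 1" "0 < Re \<nu>" and adm: "admissible \<nu> {0..b} f" and x: "x \<in> {0..b}"
    and M: "((\<lambda>u. integral {0..u} f) has_vector_derivative f (y * x)) (at (y * x) within {0..b})"
    and N: "((\<lambda>u. integral {0..u} (\<lambda>t. norm (f t))) has_vector_derivative D) (at (y * x) within {0..b})"
  shows "(RL_upper y (\<nu> + 1) f has_vector_derivative
      - (of_real y * of_real (1 - y) powr \<nu> / Gamma (\<nu> + 1) * of_real x powr \<nu> * f (x * y))
      + RL_upper y \<nu> f x) (at x within {0..b})"
proof -
  have yle: "0 \<le> y * z" "y * z \<le> z" if "z \<in> {0..b}" for z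
    using that assms(1,2) mult_left_le_one_le[of z y] by auto
  have admz: "admissible \<nu> {y * z..z} f" if "z \<in> {0..b}" for z
    using yle[OF that] that by (intro admissible_subset[OF adm]) auto
  have "((\<lambda>z. integral {y * z..z} (\<lambda>t. pos_powr \<nu> (z - t) * f t) / Gamma (\<nu> + 1)) has_vector_derivative
     (- (of_real y * pos_powr \<nu> (x - y * x) * f (y * x))
     + \<nu> * integral {y * x..x} (\<lambda>t. of_real (x - t) powr (\<nu> - 1) * f t)) / Gamma (\<nu> + 1)) (at x within {0..b})"
    by (intro has_vector_derivative_divide
        incomplete_kernel_integral_has_vector_derivative[OF assms(3,1,2) x adm M N])
  then have der: "(RL_upper y (\<nu> + 1) f has_vector_derivative
     (- (of_real y * pos_powr \<nu> (x - y * x) * f (y * x))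
     + \<nu> * integral {y * x..x} (\<lambda>t. of_real (x - t) powr (\<nu> - 1) * f t)) / Gamma (\<nu> + 1)) (at x within {0..b})"
    by (rule has_vector_derivative_transform[OF x, rotated])
       (use admz in \<open>simp add: RL_upper_eq_pos_powr assms(3) admissible_def\<close>)
  have val: "(- (of_real y * pos_powr \<nu> (x - y * x) * f (y * x))
     + \<nu> * integral {y * x..x} (\<lambda>t. of_real (x - t) powr (\<nu> - 1) * f t)) / Gamma (\<nu> + 1)
     = - (of_real y * of_real (1 - y) powr \<nu> / Gamma (\<nu> + 1) * of_real x powr \<nu> * f (x * y))
      + RL_upper y \<nu> f x"
  proof -
    have coeff: "pos_powr \<nu> (x - y * x) = of_real (1 - y) powr \<nu> * of_real x powr \<nu>"
      using x assms(2) by (intro RL_upper_boundary_coefficient) auto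
    show ?thesis
      unfolding add_divide_distrib Gamma_shift_quotient[OF assms(3)] coeff
        RL_upper_eq_integral[OF assms(3) yle(2)[OF x] admz[OF x]]
      by (simp add: mult_ac)
  qed
  show ?thesis using der unfolding val .
qed

theorem RL_upper_derivative_integral:
  assumes "0 < Re \<nu>" "y * x \<le> x" "0 \<le> x" "y \<le> 1"
    and der: "derivative_on (y * x) x f f'" and f': "f' absolutely_integrable_on {y * x..x}"
    and adm: "admissible \<nu> {y * x..x} f"
  shows "RL_upper y (\<nu> + 1) f' x =
    - (of_real x powr \<nu> / Gamma (\<nu> + 1) * of_real (1 - y) powr \<nu> * f (x * y)) + RL_upper y \<nu> f x"
proof -
  have "RL_upper y (\<nu> + 1) f' x = (- (pos_powr \<nu> (x - y * x) * f (y * x))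
      + \<nu> * integral {y * x..x} (\<lambda>t. of_real (x - t) powr (\<nu> - 1) * f t)) / Gamma (\<nu> + 1)"
    unfolding RL_upper_eq_pos_powr[OF assms(1) f'] kernel_integration_by_parts[OF assms(1,2) der f'] ..
  also have "\<dots> = - (pos_powr \<nu> (x - y * x) * f (y * x) / Gamma (\<nu> + 1)) + RL_upper y \<nu> f x"
    unfolding add_divide_distrib Gamma_shift_quotient[OF assms(1)] RL_upper_eq_integral[OF assms(1,2) adm] by simp
  finally show ?thesis
    unfolding RL_upper_boundary_coefficient[OF assms(3,4)] by (simp add: mult_ac)
qed

theorem theorem2p5:
  fixes b y :: real and \<mu> :: complex and f :: "real \<Rightarrow> complex"
  assumes "b > 0" and "0 < y" and "y < 1" and "Re \<mu> > 1"
    and "Re \<mu> > 2 \<longrightarrow> set_integrable lebesgue {0..b} f"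
    and "1 < Re \<mu> \<and> Re \<mu> \<le> 2 \<longrightarrow> Linf_on 0 b f"
  shows
    "(AE x\<in>{0..b} in lebesgue.
        (RL_upper y \<mu> f has_vector_derivative
           - (of_real y * of_real (1 - y) powr (\<mu> - 1) / Gamma \<mu>
                * of_real x powr (\<mu> - 1) * f (x * y))
           + RL_upper y (\<mu> - 1) f x) (at x within {0..b}))
     \<and> (\<forall>x\<in>{0..b}. continuous (at (x * y) within {0..b}) f \<longrightarrow>
        (RL_upper y \<mu> f has_vector_derivative
           - (of_real y * of_real (1 - y) powr (\<mu> - 1) / Gamma \<mu>
                * of_real x powr (\<mu> - 1) * f (x * y))
           + RL_upper y (\<mu> - 1) f x) (at x within {0..b}))
     \<and> (\<forall>x\<in>{0..b}. \<forall>f'.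
        derivative_on (y * x) x f f' \<and> set_integrable lebesgue {y * x..x} f' \<longrightarrow>
        RL_upper y \<mu> f' x =
          - (of_real x powr (\<mu> - 1) / Gamma \<mu> * of_real (1 - y) powr (\<mu> - 1) * f (x * y))
          + RL_upper y (\<mu> - 1) f x)"
    (is "(AE x\<in>{0..b} in lebesgue. ?D x) \<and> (\<forall>x\<in>{0..b}. _ x \<longrightarrow> ?D x) \<and> _")
proof -
  define \<nu> where "\<nu> = \<mu> - 1"
  have \<nu>: "0 < Re \<nu>" "\<nu> + 1 = \<mu>" using assms(4) by (auto simp: \<nu>_def)
  have adm: "admissible \<nu> {0..b} f"
  proof (cases "Re \<mu> > 2")
    case True
    then show ?thesis using assms(5) by (simp add: admissible_def \<nu>_def)
  next
    case False
    then show ?thesis using assms(4,6) by (intro Linf_on_imp_admissible) simp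
  qed
  then have fi: "f integrable_on {0..b}" and nf: "(\<lambda>t. norm (f t)) integrable_on {0..b}"
    by (auto simp: admissible_def absolutely_integrable_on_def)
  have ymem: "y * x \<in> {0..b}" "y * x \<le> x" if "x \<in> {0..b}" for x
    using that assms(2,3) mult_left_le_one_le[of x y] by auto
  have D: "?D x" if "x \<in> {0..b}"
      "((\<lambda>u. integral {0..u} f) has_vector_derivative f (y * x)) (at (y * x) within {0..b})"
      "((\<lambda>u. integral {0..u} (\<lambda>t. norm (f t))) has_vector_derivative norm (f (y * x))) (at (y * x) within {0..b})"
    for x
    using RL_upper_has_vector_derivative[OF assms(2,3) \<nu>(1) adm that, unfolded \<nu>(2)] unfolding \<nu>_def .
  have "AE x in lebesgue. x \<in> {0..b} \<longrightarrow> ?D x"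
    unfolding AE_lebesgue_iff_negligible
  proof (rule negligible_subset)
    let ?N1 = "{u\<in>{0..b}. \<not> ((\<lambda>u. integral {0..u} f) has_vector_derivative f u) (at u within {0..b})}"
    let ?N2 = "{u\<in>{0..b}. \<not> ((\<lambda>u. integral {0..u} (\<lambda>t. norm (f t))) has_vector_derivative norm (f u)) (at u within {0..b})}"
    \<comment> \<open>A bad \<open>x\<close> comes from a bad point \<open>u = y * x\<close>, and rescaling preserves null sets.\<close>
    have "negligible (?N1 \<union> ?N2)"
      by (intro negligible_Un indefinite_integral_has_vector_derivative_AE fi nf)
    then show "negligible ((\<lambda>u. u / y) ` (?N1 \<union> ?N2))"
      by (rule negligible_differentiable_image_negligible[OF order_refl])
         (use \<open>0 < y\<close> in \<open>auto simp: differentiable_on_def intro!: derivative_intros\<close>)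
    show "{x. \<not> (x \<in> {0..b} \<longrightarrow> ?D x)} \<subseteq> (\<lambda>u. u / y) ` (?N1 \<union> ?N2)"
    proof
      fix x assume "x \<in> {x. \<not> (x \<in> {0..b} \<longrightarrow> ?D x)}"
      then have x: "x \<in> {0..b}" and "\<not> ?D x" by auto
      then have "y * x \<in> ?N1 \<union> ?N2" using D[OF x] ymem(1)[OF x] by blast
      then show "x \<in> (\<lambda>u. u / y) ` (?N1 \<union> ?N2)"
        using \<open>0 < y\<close> by (intro image_eqI[of _ _ "y * x"]) auto
    qed
  qed
  moreover have "?D x" if x: "x \<in> {0..b}" and cont: "continuous (at (x * y) within {0..b}) f" for x
  proof (rule D[OF x])
    have c: "continuous (at (y * x) within {0..b}) f" using cont by (simp add: mult.commute)
    show "((\<lambda>u. integral {0..u} f) has_vector_derivative f (y * x)) (at (y * x) within {0..b})"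
      using integral_has_vector_derivative_continuous_at[OF fi, of "y * x" "{}"] ymem(1)[OF x] c by simp
    show "((\<lambda>u. integral {0..u} (\<lambda>t. norm (f t))) has_vector_derivative norm (f (y * x))) (at (y * x) within {0..b})"
      using integral_has_vector_derivative_continuous_at[OF nf, of "y * x" "{}"] ymem(1)[OF x]
        continuous_norm[OF c] by simp
  qed
  moreover have "RL_upper y \<mu> f' x =
          - (of_real x powr (\<mu> - 1) / Gamma \<mu> * of_real (1 - y) powr (\<mu> - 1) * f (x * y))
          + RL_upper y (\<mu> - 1) f x"
    if x: "x \<in> {0..b}" and der: "derivative_on (y * x) x f f'" "set_integrable lebesgue {y * x..x} f'" for x f'
  proof -
    have "admissible \<nu> {y * x..x} f"
      using ymem[OF x] x by (intro admissible_subset[OF adm]) auto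
    then show ?thesis
      using RL_upper_derivative_integral[OF \<nu>(1) ymem(2)[OF x] _ _ der, unfolded \<nu>(2)] x assms(3)
      unfolding \<nu>_def by simp
  qed
  ultimately show ?thesis by blast
qed

end
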